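(* Let $G$ be a finitely generated group with $0<\operatorname{asdim} G<\infty$. Then $G$ can be coarsely separated by a set $Y$ with $\operatorname{asdim} Y<\operatorname{asdim} G$.
   Context: Asymptotic dimension: for a metric space $X$ and an integer $n\ge 0$, $\operatorname{asdim} X\le n$ iff for every $R>0$ there is a uniformly bounded covering $\mathcal U$ of $X$ (i.e. $\sup_{U\in\mathcal U}\operatorname{diam}U<\infty$) such that every ball of radius $R$ in $X$ intersects at most $n+1$ elements of $\mathcal U$. Subsets carry the restricted metric. For a finitely generated group $G$, $\operatorname{asdim}G$ is the asymptotic dimension of a Cayley graph $\operatorname{Cay}(G,S)$ ($S$ a finite generating set) with its graph metric; it does not depend on $S$. For $A\subseteq X$, $N_R(A)$ is the set of points of $X$ at distance at most $R$ from $A$. Coarse separation: let $X$ be a metric space and $K\subseteq X$. A component $C$ of $X\setminus N_R(K)$ is deep if $C$ is not contained in $N_{R'}(K)$ for any $R'>0$. The set $K$ coarsely separates $X$ if there is an $R>0$ such that $X\setminus N_R(K)$ has at least two deep connected components. A finitely generated group $G$ can be coarsely separated by a set $Y$ if there exists a finite generating set $S$ of $G$ such that $Y\subseteq \operatorname{Cay}(G,S)$ and $Y$ coarsely separates $\operatorname{Cay}(G,S)$. *)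

theory Defs
  imports
    "HOL-Analysis.Abstract_Metric_Spaces"
    "HOL-Library.Extended_Nat"
    "HOL-Algebra.Generated_Groups"
begin

section \<open>Asymptotic dimension\<close>

definition uniformly_bounded_cover :: "'a metric \<Rightarrow> 'a set set \<Rightarrow> bool" where
  "uniformly_bounded_cover m \<U> \<longleftrightarrow>
     \<Union>\<U> = mspace m \<and> (\<exists>D. \<forall>U\<in>\<U>. \<forall>x\<in>U. \<forall>y\<in>U. mdist m x y \<le> D)"

definition asdim_le :: "'a metric \<Rightarrow> nat \<Rightarrow> bool" where
  "asdim_le m n \<longleftrightarrow>
     (\<forall>R>0. \<exists>\<U>. uniformly_bounded_cover m \<U> \<and>
        (\<forall>x\<in>mspace m. finite {U\<in>\<U>. U \<inter> mcball_of m x R \<noteq> {}} \<and>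
                       card {U\<in>\<U>. U \<inter> mcball_of m x R \<noteq> {}} \<le> n + 1))"

text \<open>The infimum over the empty set is \<open>\<infinity>\<close>, the value for spaces of infinite asymptotic
  dimension. The empty space has asymptotic dimension 0, as every bounded one.\<close>

definition asdim :: "'a metric \<Rightarrow> enat" where
  "asdim m = Inf {enat n |n. asdim_le m n}"

section \<open>Coarse separation\<close>

text \<open>Points at distance (an infimum) at most \<open>R\<close> from \<open>A\<close>. The infimum of the empty set of reals
  has no useful value, so that case is excluded: the neighbourhoods of \<open>{}\<close> are empty.\<close>

definition nbhd :: "'a metric \<Rightarrow> real \<Rightarrow> 'a set \<Rightarrow> 'a set" where
  "nbhd m R A = {x \<in> mspace m. A \<noteq> {} \<and> (INF a\<in>A. mdist m x a) \<le> R}"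

definition deep :: "'a metric \<Rightarrow> 'a set \<Rightarrow> 'a set \<Rightarrow> bool" where
  "deep m K C \<longleftrightarrow> (\<forall>R>0. \<not> C \<subseteq> nbhd m R K)"

definition coarsely_separates :: "'a metric \<Rightarrow> 'a set \<Rightarrow> bool" where
  "coarsely_separates m K \<longleftrightarrow> K \<subseteq> mspace m \<and>
     (\<exists>R>0. \<exists>C D. C \<noteq> D \<and>
        {C, D} \<subseteq> connected_components_of (subtopology (mtopology_of m) (mspace m - nbhd m R K)) \<and>
        deep m K C \<and> deep m K D)"

section \<open>Graphs as metric spaces\<close>

text \<open>A simple graph is given by its vertex set \<open>V\<close> and a symmetric irreflexive adjacency relation
  \<open>E\<close> on \<open>V\<close>. A point of its geometric realization is represented by its barycentric coordinates:
  vertices have one nonzero coordinate, interior points of an edge have two.\<close>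

definition supp :: "('a \<Rightarrow> real) \<Rightarrow> 'a set" where
  "supp \<phi> = {v. \<phi> v \<noteq> 0}"

definition realization :: "'a set \<Rightarrow> ('a \<times> 'a) set \<Rightarrow> ('a \<Rightarrow> real) set" where
  "realization V E =
     {\<phi>. (\<forall>v. 0 \<le> \<phi> v) \<and> sum \<phi> (supp \<phi>) = 1 \<and>
         ((\<exists>v\<in>V. supp \<phi> = {v}) \<or> (\<exists>(u, v)\<in>E. supp \<phi> = {u, v}))}"

definition vertex_dist :: "('a \<times> 'a) set \<Rightarrow> 'a \<Rightarrow> 'a \<Rightarrow> nat" where
  "vertex_dist E u v = (LEAST n. (u, v) \<in> E ^^ n)"

text \<open>The path metric in which every edge is isometric to the unit interval. The distance from a
  point \<open>\<phi>\<close> to an end point \<open>u\<close> of its edge is \<open>1 - \<phi> u\<close>. Two interior points of the same edge are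
  joined by a segment of that edge; otherwise a shortest path from \<open>\<phi>\<close> to \<open>\<psi>\<close> passes through an end
  point of the edge of \<open>\<phi>\<close> and an end point of the edge of \<open>\<psi>\<close>.\<close>

definition path_dist :: "('a \<times> 'a) set \<Rightarrow> ('a \<Rightarrow> real) \<Rightarrow> ('a \<Rightarrow> real) \<Rightarrow> real" where
  "path_dist E \<phi> \<psi> =
     (if supp \<phi> = supp \<psi> then MAX v\<in>supp \<phi>. \<bar>\<phi> v - \<psi> v\<bar>
      else MIN (u, v)\<in>supp \<phi> \<times> supp \<psi>. (1 - \<phi> u) + real (vertex_dist E u v) + (1 - \<psi> v))"

text \<open>The library's metrics are nonnegative and symmetric everywhere, hence the value 0 outside of the
  realization.\<close>

definition graph_metric :: "'a set \<Rightarrow> ('a \<times> 'a) set \<Rightarrow> ('a \<Rightarrow> real) metric" where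
  "graph_metric V E = metric (realization V E,
     \<lambda>\<phi> \<psi>. if \<phi> \<in> realization V E \<and> \<psi> \<in> realization V E then path_dist E \<phi> \<psi> else 0)"

locale connected_graph =
  fixes V :: "'a set" and E :: "('a \<times> 'a) set"
  assumes edges: "E \<subseteq> V \<times> V" and sym: "sym E" and irrefl: "irrefl E"
    and connected: "u \<in> V \<Longrightarrow> v \<in> V \<Longrightarrow> (u, v) \<in> E\<^sup>*"
begin

lemma vertex_dist_relpow:
  assumes "u \<in> V" "v \<in> V"
  shows "(u, v) \<in> E ^^ vertex_dist E u v"
  unfolding vertex_dist_def
  by (rule LeastI_ex) (use connected[OF assms] rtrancl_power in blast)

lemma vertex_dist_le: "(u, v) \<in> E ^^ n \<Longrightarrow> vertex_dist E u v \<le> n"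
  unfolding vertex_dist_def by (rule Least_le)

lemma relpow_sym: "(u, v) \<in> E ^^ n \<Longrightarrow> (v, u) \<in> E ^^ n"
proof (induction n arbitrary: v)
  case (Suc n)
  then obtain w where "(u, w) \<in> E ^^ n" "(w, v) \<in> E" by auto
  then show ?case
    using Suc.IH sym by (meson relpow_Suc_I2 symD)
qed auto

lemma vertex_dist_sym:
  assumes "u \<in> V" "v \<in> V"
  shows "vertex_dist E u v = vertex_dist E v u"
  by (meson assms order_antisym relpow_sym vertex_dist_le vertex_dist_relpow)

lemma vertex_dist_triangle:
  assumes "u \<in> V" "v \<in> V" "w \<in> V"
  shows "vertex_dist E u w \<le> vertex_dist E u v + vertex_dist E v w"
  by (rule vertex_dist_le) (use assms vertex_dist_relpow in \<open>auto simp: relpow_add\<close>)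

lemma vertex_dist_self [simp]: "vertex_dist E u u = 0"
  using vertex_dist_le[of u u 0] by simp

lemma vertex_dist_eq_0: "u \<in> V \<Longrightarrow> v \<in> V \<Longrightarrow> vertex_dist E u v = 0 \<Longrightarrow> u = v"
  using vertex_dist_relpow[of u v] by simp

lemma vertex_dist_edge: "(u, v) \<in> E \<Longrightarrow> vertex_dist E u v \<le> 1"
  by (rule vertex_dist_le) simp

lemma realization_cases:
  assumes "\<phi> \<in> realization V E"
  obtains (vertex) v where "v \<in> V" "supp \<phi> = {v}" "\<phi> v = 1"
  | (edge) u v where "u \<in> V" "v \<in> V" "u \<noteq> v" "(u, v) \<in> E" "(v, u) \<in> E" "supp \<phi> = {u, v}"
      "\<phi> u > 0" "\<phi> v > 0" "\<phi> v = 1 - \<phi> u"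
proof -
  have nn: "\<And>v. 0 \<le> \<phi> v" and s1: "sum \<phi> (supp \<phi>) = 1"
    using assms by (auto simp: realization_def)
  consider v where "v \<in> V" "supp \<phi> = {v}" | u v where "(u, v) \<in> E" "supp \<phi> = {u, v}"
    using assms by (auto simp: realization_def)
  then show thesis
  proof cases
    case 1
    then show thesis using s1 vertex by auto
  next
    case (2 u v)
    have ne: "u \<noteq> v" using 2 irrefl by (auto simp: irrefl_def)
    have "\<phi> u \<noteq> 0" "\<phi> v \<noteq> 0" using 2(2) by (auto simp: supp_def)
    then have "\<phi> u > 0" "\<phi> v > 0" using nn by (metis order_le_less)+
    moreover have "\<phi> v = 1 - \<phi> u" using s1 2(2) ne by simp
    ultimately show thesis using edge[of u v] 2 ne edges sym by (auto dest: symD)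
  qed
qed

lemma supp_facts:
  assumes "\<phi> \<in> realization V E"
  shows "finite (supp \<phi>)" "supp \<phi> \<noteq> {}" "supp \<phi> \<subseteq> V" "\<phi> v \<le> 1" "0 \<le> \<phi> v"
proof -
  show "0 \<le> \<phi> v" using assms by (auto simp: realization_def)
  show "finite (supp \<phi>)" "supp \<phi> \<noteq> {}" "supp \<phi> \<subseteq> V"
    by (use assms in \<open>cases rule: realization_cases; auto\<close>)+
  show "\<phi> v \<le> 1"
  proof (cases "v \<in> supp \<phi>")
    case True
    with assms show ?thesis by (cases rule: realization_cases) auto
  qed (auto simp: supp_def)
qed

lemma vertex_dist_supp:
  assumes "\<phi> \<in> realization V E" "u \<in> supp \<phi>" "v \<in> supp \<phi>"
  shows "real (vertex_dist E u v) \<le> (1 - \<phi> u) + (1 - \<phi> v)"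
  using assms(1)
proof (cases rule: realization_cases)
  case (edge a b)
  then have "vertex_dist E a b \<le> 1" "vertex_dist E b a \<le> 1"
    using vertex_dist_edge by blast+
  then show ?thesis using assms(2,3) edge by auto
qed (use assms in auto)

lemma path_dist_same:
  assumes "\<phi> \<in> realization V E" "\<psi> \<in> realization V E" "supp \<phi> = supp \<psi>" "v \<in> supp \<phi>"
  shows "path_dist E \<phi> \<psi> = \<bar>\<phi> v - \<psi> v\<bar>"
  using assms(1)
proof (cases rule: realization_cases)
  case (vertex w)
  then show ?thesis using assms by (auto simp: path_dist_def)
next
  case e: (edge a b)
  have "\<psi> b = 1 - \<psi> a"
    using assms(2)
  proof (cases rule: realization_cases)
    case (vertex w)
    then show ?thesis using e assms(3) by auto
  next
    case (edge c d)
    then show ?thesis using e assms(3) by (auto simp: doubleton_eq_iff)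
  qed
  then have eq: "\<bar>\<phi> x - \<psi> x\<bar> = \<bar>\<phi> v - \<psi> v\<bar>" if "x \<in> supp \<phi>" for x
    using that assms(4) e(6,9) by auto
  have "(\<lambda>x. \<bar>\<phi> x - \<psi> x\<bar>) ` supp \<phi> = (\<lambda>x. \<bar>\<phi> v - \<psi> v\<bar>) ` supp \<phi>"
    by (rule image_cong[OF refl eq])
  also have "\<dots> = {\<bar>\<phi> v - \<psi> v\<bar>}"
    using assms(4) by (rule image_constant)
  finally have "(\<lambda>x. \<bar>\<phi> x - \<psi> x\<bar>) ` supp \<phi> = {\<bar>\<phi> v - \<psi> v\<bar>}" .
  then show ?thesis using assms(3) by (simp add: path_dist_def)
qed

lemma path_dist_le:
  assumes "\<phi> \<in> realization V E" "\<psi> \<in> realization V E" "u \<in> supp \<phi>" "v \<in> supp \<psi>"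
  shows "path_dist E \<phi> \<psi> \<le> (1 - \<phi> u) + real (vertex_dist E u v) + (1 - \<psi> v)"
proof (cases "supp \<phi> = supp \<psi>")
  case True
  have d: "path_dist E \<phi> \<psi> = \<bar>\<phi> u - \<psi> u\<bar>"
    using path_dist_same assms True by blast
  show ?thesis
  proof (cases "u = v")
    case True
    then show ?thesis using d supp_facts(4)[OF assms(1), of u] supp_facts(4)[OF assms(2), of u] by auto
  next
    case False
    then have "real (vertex_dist E u v) \<ge> 1"
      using vertex_dist_eq_0[of u v] assms supp_facts(3) by (metis One_nat_def Suc_leI gr0I of_nat_1 of_nat_le_iff subsetD)
    then show ?thesis
      using d supp_facts(4,5)[OF assms(1), of u] supp_facts(4,5)[OF assms(2), of u]
        supp_facts(4)[OF assms(2), of v] by auto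
  qed
next
  case False
  have "finite (supp \<phi> \<times> supp \<psi>)" using assms supp_facts by blast
  then show ?thesis using False assms(3,4) unfolding path_dist_def
    by (auto intro!: Min_le)
qed

lemma path_dist_attained:
  assumes "\<phi> \<in> realization V E" "\<psi> \<in> realization V E" "supp \<phi> \<noteq> supp \<psi>"
  obtains u v where "u \<in> supp \<phi>" "v \<in> supp \<psi>"
    "path_dist E \<phi> \<psi> = (1 - \<phi> u) + real (vertex_dist E u v) + (1 - \<psi> v)"
proof -
  let ?f = "\<lambda>(u, v). (1 - \<phi> u) + real (vertex_dist E u v) + (1 - \<psi> v)"
  have "finite (supp \<phi> \<times> supp \<psi>)" "supp \<phi> \<times> supp \<psi> \<noteq> {}" using assms supp_facts by blast+
  then have "Min (?f ` (supp \<phi> \<times> supp \<psi>)) \<in> ?f ` (supp \<phi> \<times> supp \<psi>)"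
    by (intro Min_in) auto
  moreover have "path_dist E \<phi> \<psi> = Min (?f ` (supp \<phi> \<times> supp \<psi>))"
    using assms(3) by (simp add: path_dist_def)
  ultimately show thesis using that by auto
qed

lemma path_dist_sym:
  assumes "\<phi> \<in> realization V E" "\<psi> \<in> realization V E"
  shows "path_dist E \<phi> \<psi> = path_dist E \<psi> \<phi>"
proof -
  have le: "path_dist E \<phi> \<psi> \<le> path_dist E \<psi> \<phi>"
    if real: "\<phi> \<in> realization V E" "\<psi> \<in> realization V E" for \<phi> \<psi>
  proof (cases "supp \<phi> = supp \<psi>")
    case True
    then obtain v where "v \<in> supp \<phi>" "v \<in> supp \<psi>" using supp_facts(2) real by blast
    then show ?thesis
      using path_dist_same[OF real True, of v] path_dist_same[OF real(2,1) True[symmetric], of v] by simp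
  next
    case False
    then obtain u v where "u \<in> supp \<psi>" "v \<in> supp \<phi>"
      "path_dist E \<psi> \<phi> = (1 - \<psi> u) + real (vertex_dist E u v) + (1 - \<phi> v)"
      using path_dist_attained[OF real(2,1) False[symmetric]] by blast
    moreover from this have "vertex_dist E u v = vertex_dist E v u"
      using vertex_dist_sym supp_facts(3) real by blast
    ultimately show ?thesis using path_dist_le[of \<phi> \<psi> v u] real by simp
  qed
  show ?thesis using le[OF assms] le[OF assms(2,1)] by simp
qed

lemma path_dist_triangle:
  assumes "\<phi> \<in> realization V E" "\<psi> \<in> realization V E" "\<theta> \<in> realization V E"
  shows "path_dist E \<phi> \<theta> \<le> path_dist E \<phi> \<psi> + path_dist E \<psi> \<theta>"
proof -
  consider "supp \<phi> = supp \<psi>" "supp \<psi> = supp \<theta>" | "supp \<phi> = supp \<psi>" "supp \<psi> \<noteq> supp \<theta>"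
    | "supp \<phi> \<noteq> supp \<psi>" "supp \<psi> = supp \<theta>" | "supp \<phi> \<noteq> supp \<psi>" "supp \<psi> \<noteq> supp \<theta>" by blast
  then show ?thesis
  proof cases
    case 1
    then obtain v where v: "v \<in> supp \<phi>" "v \<in> supp \<psi>" "v \<in> supp \<theta>"
      using supp_facts(2) assms by blast
    then show ?thesis using path_dist_same[OF assms(1,2), of v] path_dist_same[OF assms(2,3), of v]
        path_dist_same[OF assms(1,3), of v] 1 by simp
  next
    case 2
    then obtain u v where uv: "u \<in> supp \<psi>" "v \<in> supp \<theta>"
      "path_dist E \<psi> \<theta> = (1 - \<psi> u) + real (vertex_dist E u v) + (1 - \<theta> v)"
      using path_dist_attained[OF assms(2,3) 2(2)] by blast
    have "path_dist E \<phi> \<psi> = \<bar>\<phi> u - \<psi> u\<bar>"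
      using path_dist_same assms 2 uv by blast
    then show ?thesis using path_dist_le[OF assms(1,3), of u v] uv 2 by auto
  next
    case 3
    then obtain u v where uv: "u \<in> supp \<phi>" "v \<in> supp \<psi>"
      "path_dist E \<phi> \<psi> = (1 - \<phi> u) + real (vertex_dist E u v) + (1 - \<psi> v)"
      using path_dist_attained[OF assms(1,2) 3(1)] by blast
    have "path_dist E \<psi> \<theta> = \<bar>\<psi> v - \<theta> v\<bar>"
      using path_dist_same assms 3 uv by blast
    then show ?thesis using path_dist_le[OF assms(1,3), of u v] uv 3 by auto
  next
    case 4
    then obtain u v where uv: "u \<in> supp \<phi>" "v \<in> supp \<psi>"
      "path_dist E \<phi> \<psi> = (1 - \<phi> u) + real (vertex_dist E u v) + (1 - \<psi> v)"
      using path_dist_attained[OF assms(1,2) 4(1)] by blast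
    obtain w x where wx: "w \<in> supp \<psi>" "x \<in> supp \<theta>"
      "path_dist E \<psi> \<theta> = (1 - \<psi> w) + real (vertex_dist E w x) + (1 - \<theta> x)"
      using path_dist_attained[OF assms(2,3) 4(2)] by blast
    have V: "u \<in> V" "v \<in> V" "w \<in> V" "x \<in> V"
      using uv wx supp_facts(3) assms by blast+
    have "vertex_dist E u x \<le> vertex_dist E u v + vertex_dist E v w + vertex_dist E w x"
      using vertex_dist_triangle[of u v x] vertex_dist_triangle[of v w x] V by linarith
    then have "real (vertex_dist E u x) \<le>
        real (vertex_dist E u v) + real (vertex_dist E v w) + real (vertex_dist E w x)"
      by (metis of_nat_add of_nat_le_iff)
    then show ?thesis
      using path_dist_le[OF assms(1,3) uv(1) wx(2)] vertex_dist_supp[OF assms(2) uv(2) wx(1)] uv(3) wx(3)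
      by linarith
  qed
qed

lemma path_dist_nonneg:
  assumes "\<phi> \<in> realization V E" "\<psi> \<in> realization V E"
  shows "0 \<le> path_dist E \<phi> \<psi>"
proof -
  obtain v where v: "v \<in> supp \<phi>" using supp_facts(2) assms by blast
  have "path_dist E \<phi> \<phi> = 0" using path_dist_same[OF assms(1,1) _ v] by simp
  then show ?thesis
    using path_dist_triangle[OF assms assms(1)] path_dist_sym[OF assms] by simp
qed

lemma path_dist_eq_0_iff:
  assumes "\<phi> \<in> realization V E" "\<psi> \<in> realization V E"
  shows "path_dist E \<phi> \<psi> = 0 \<longleftrightarrow> \<phi> = \<psi>"
proof
  assume "\<phi> = \<psi>"
  moreover obtain v where "v \<in> supp \<phi>" using supp_facts(2) assms by blast
  ultimately show "path_dist E \<phi> \<psi> = 0" using path_dist_same[OF assms] by simp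
next
  assume 0: "path_dist E \<phi> \<psi> = 0"
  show "\<phi> = \<psi>"
  proof (cases "supp \<phi> = supp \<psi>")
    case True
    show ?thesis
    proof
      fix v
      show "\<phi> v = \<psi> v"
      proof (cases "v \<in> supp \<phi>")
        case in_supp: True
        then show ?thesis using path_dist_same[OF assms True] 0 by simp
      next
        case False
        then show ?thesis using True by (auto simp: supp_def)
      qed
    qed
  next
    case False
    then obtain u v where uv: "u \<in> supp \<phi>" "v \<in> supp \<psi>"
      "path_dist E \<phi> \<psi> = (1 - \<phi> u) + real (vertex_dist E u v) + (1 - \<psi> v)"
      using path_dist_attained[OF assms False] by blast
    have "\<phi> u = 1 \<and> \<psi> v = 1 \<and> vertex_dist E u v = 0"
      using uv(3) 0 supp_facts(4)[OF assms(1), of u] supp_facts(4)[OF assms(2), of v] by linarith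
    moreover from this have "u = v" using vertex_dist_eq_0 uv supp_facts(3) assms by blast
    moreover have "supp \<phi> = {u}" if "\<phi> \<in> realization V E" "u \<in> supp \<phi>" "\<phi> u = 1" for \<phi> u
      using that(1) by (cases rule: realization_cases) (use that in auto)
    ultimately have "supp \<phi> = supp \<psi>" using uv assms by metis
    then show ?thesis using False by simp
  qed
qed

lemma Metric_space_realization:
  "Metric_space (realization V E)
     (\<lambda>\<phi> \<psi>. if \<phi> \<in> realization V E \<and> \<psi> \<in> realization V E then path_dist E \<phi> \<psi> else 0)"
  by unfold_locales (auto simp: path_dist_nonneg path_dist_sym path_dist_eq_0_iff path_dist_triangle)

lemma mspace_graph_metric [simp]: "mspace (graph_metric V E) = realization V E"
  unfolding graph_metric_def by (rule Metric_space.mspace_metric[OF Metric_space_realization])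

lemma mdist_graph_metric:
  "\<phi> \<in> realization V E \<Longrightarrow> \<psi> \<in> realization V E \<Longrightarrow> mdist (graph_metric V E) \<phi> \<psi> = path_dist E \<phi> \<psi>"
  unfolding graph_metric_def by (simp add: Metric_space.mdist_metric[OF Metric_space_realization])

end

section \<open>Cayley graphs and finitely generated groups\<close>

definition finite_generating_set :: "('a, 'b) monoid_scheme \<Rightarrow> 'a set \<Rightarrow> bool" where
  "finite_generating_set G S \<longleftrightarrow> finite S \<and> S \<subseteq> carrier G \<and> generate G S = carrier G"

definition finitely_generated :: "('a, 'b) monoid_scheme \<Rightarrow> bool" where
  "finitely_generated G \<longleftrightarrow> (\<exists>S. finite_generating_set G S)"

definition cayley_edges :: "('a, 'b) monoid_scheme \<Rightarrow> 'a set \<Rightarrow> ('a \<times> 'a) set" where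
  "cayley_edges G S =
     {(g, h). g \<in> carrier G \<and> h \<in> carrier G \<and> g \<noteq> h \<and> (\<exists>s\<in>S. h = g \<otimes>\<^bsub>G\<^esub> s \<or> g = h \<otimes>\<^bsub>G\<^esub> s)}"

definition Cay :: "('a, 'b) monoid_scheme \<Rightarrow> 'a set \<Rightarrow> ('a \<Rightarrow> real) metric" where
  "Cay G S = graph_metric (carrier G) (cayley_edges G S)"

lemma (in group) generate_imp_path:
  assumes "S \<subseteq> carrier G" "x \<in> generate G S" "g \<in> carrier G"
  shows "(g, g \<otimes> x) \<in> (cayley_edges G S)\<^sup>*"
  using assms(2,3)
proof (induction arbitrary: g rule: generate.induct)
  case (incl h)
  then show ?case using assms(1)
    by (cases "g = g \<otimes> h") (auto simp: cayley_edges_def intro!: r_into_rtrancl)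
next
  case (inv h)
  then have "h \<in> carrier G" "g = g \<otimes> inv h \<otimes> h" using assms(1) by (auto simp: m_assoc)
  then show ?case using inv
    by (cases "g = g \<otimes> inv h") (auto simp: cayley_edges_def intro!: r_into_rtrancl)
next
  case (eng h1 h2)
  then have c: "h1 \<in> carrier G" "h2 \<in> carrier G"
    using generate_in_carrier[OF assms(1)] by auto
  have "(g, g \<otimes> h1) \<in> (cayley_edges G S)\<^sup>*" using eng by blast
  also have "(g \<otimes> h1, g \<otimes> h1 \<otimes> h2) \<in> (cayley_edges G S)\<^sup>*" using eng c by simp
  finally show ?case using eng c by (simp add: m_assoc)
qed simp

lemma (in group) connected_graph_cayley:
  assumes "finite_generating_set G S"
  shows "connected_graph (carrier G) (cayley_edges G S)"
proof
  show "cayley_edges G S \<subseteq> carrier G \<times> carrier G" by (auto simp: cayley_edges_def)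
  show "sym (cayley_edges G S)" by (auto simp: cayley_edges_def sym_def)
  show "irrefl (cayley_edges G S)" by (auto simp: cayley_edges_def irrefl_def)
  fix u v assume uv: "u \<in> carrier G" "v \<in> carrier G"
  then have "inv u \<otimes> v \<in> generate G S" "u \<otimes> (inv u \<otimes> v) = v"
    using assms by (auto simp: finite_generating_set_def m_assoc[symmetric])
  then show "(u, v) \<in> (cayley_edges G S)\<^sup>*"
    using generate_imp_path[of S "inv u \<otimes> v" u] uv assms by (simp add: finite_generating_set_def)
qed

text \<open>The value does not depend on the finite generating set chosen.\<close>

definition group_asdim :: "('a, 'b) monoid_scheme \<Rightarrow> enat" where
  "group_asdim G = asdim (Cay G (SOME S. finite_generating_set G S))"

text \<open>The generating set is a parameter since it determines the metric on \<open>Y\<close>.\<close>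

definition group_coarsely_separated_by :: "('a, 'b) monoid_scheme \<Rightarrow> 'a set \<Rightarrow> ('a \<Rightarrow> real) set \<Rightarrow> bool" where
  "group_coarsely_separated_by G S Y \<longleftrightarrow>
     finite_generating_set G S \<and> Y \<subseteq> mspace (Cay G S) \<and> coarsely_separates (Cay G S) Y"

end

theory Submission
  imports Defs
begin

text \<open>Let \<open>m\<close> have asymptotic dimension \<open>n + 1\<close>. For every scale \<open>L\<close> there is a cover whose multiplicity
  \<open>n + 2\<close> at scale \<open>L\<close> is attained only on a bad set that splits into uniformly bounded, widely separated
  clusters. A subset that avoids, for each \<open>L\<close>, the bad set of scale \<open>L\<close> outside a bounded set has
  asymptotic dimension at most \<open>n\<close>. Any set \<open>T\<close> can be enlarged, by an amount that is small relative to
  the distance from a base point, to a set \<open>A\<close> that does not cut distant clusters, so that the frontier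
  of \<open>A\<close> is such a subset. An infinite finitely generated group contains a bi-infinite geodesic, and for \<open>T\<close>
  a cone around one of its ends the frontier of \<open>A\<close> separates this end from the other one.\<close>

section \<open>Separating sets of smaller asymptotic dimension\<close>

definition asdim_le_at :: "'a metric \<Rightarrow> real \<Rightarrow> nat \<Rightarrow> bool" where
  "asdim_le_at m R n \<longleftrightarrow> (\<exists>\<U>. uniformly_bounded_cover m \<U> \<and>
     (\<forall>x\<in>mspace m. finite {U\<in>\<U>. U \<inter> mcball_of m x R \<noteq> {}} \<and>
                    card {U\<in>\<U>. U \<inter> mcball_of m x R \<noteq> {}} \<le> n + 1))"

lemma asdim_le_iff_at: "asdim_le m n \<longleftrightarrow> (\<forall>R>0. asdim_le_at m R n)"
  by (simp add: asdim_le_def asdim_le_at_def)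

lemma asdim_le_at_mono:
  assumes "asdim_le_at m L n" "R \<le> L"
  shows "asdim_le_at m R n"
proof -
  obtain \<U> where ub: "uniformly_bounded_cover m \<U>"
    and \<U>: "\<And>x. x \<in> mspace m \<Longrightarrow> finite {U\<in>\<U>. U \<inter> mcball_of m x L \<noteq> {}} \<and>
                    card {U\<in>\<U>. U \<inter> mcball_of m x L \<noteq> {}} \<le> n + 1"
    using assms(1) unfolding asdim_le_at_def by blast
  have "finite {U\<in>\<U>. U \<inter> mcball_of m x R \<noteq> {}} \<and> card {U\<in>\<U>. U \<inter> mcball_of m x R \<noteq> {}} \<le> n + 1"
    if "x \<in> mspace m" for x
  proof -
    have "mcball_of m x R \<subseteq> mcball_of m x L"
      using assms(2) by auto
    then have "{U\<in>\<U>. U \<inter> mcball_of m x R \<noteq> {}} \<subseteq> {U\<in>\<U>. U \<inter> mcball_of m x L \<noteq> {}}"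
      by blast
    then show ?thesis
      using \<U>[OF that] by (meson card_mono finite_subset le_trans)
  qed
  then show ?thesis
    using ub unfolding asdim_le_at_def by blast
qed

lemma mdist_self [simp]: "x \<in> mspace m \<Longrightarrow> mdist m x x = 0"
  by simp

text \<open>The fibres of \<open>c\<close> on \<open>B\<close> are the clusters: \<open>D\<close>
  bounds their diameters, and different clusters are more than \<open>s\<close> apart. The last
  clause is all that later arguments retain of the cover.\<close>

definition bad_points :: "'a metric \<Rightarrow> real \<Rightarrow> nat \<Rightarrow> real \<Rightarrow> 'a set \<Rightarrow> ('a \<Rightarrow> 'b) \<Rightarrow> real \<Rightarrow> bool" where
  "bad_points m L n s B c D \<longleftrightarrow> D \<ge> 0 \<and> B \<subseteq> mspace m \<and>
    (\<forall>x\<in>B. \<forall>y\<in>B. mdist m x y \<le> s \<longrightarrow> c x = c y) \<and>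
    (\<forall>x\<in>B. \<forall>y\<in>B. c x = c y \<longrightarrow> mdist m x y \<le> D) \<and>
    (\<forall>Y p r. Y \<subseteq> mspace m \<longrightarrow> p \<in> mspace m \<longrightarrow> (\<forall>x\<in>Y \<inter> B. mdist m p x \<le> r) \<longrightarrow>
       asdim_le_at (submetric m Y) L n)"

text \<open>\<open>B\<close> consists of the points whose \<open>L\<close>-ball meets the maximal number of elements of a cover,
  and \<open>c\<close> assigns to such a point the set of these elements. If \<open>Y\<close> meets \<open>B\<close> in a bounded set only,
  then merging the cover elements near that set leaves a cover of smaller \<open>L\<close>-multiplicity on \<open>Y\<close>.\<close>

lemma bad_points_exist:
  fixes m :: "'a metric"
  assumes "asdim_le m (Suc n)" "L > 0" "s \<ge> 0"
  shows "\<exists>B (c :: 'a \<Rightarrow> 'a set set) D. bad_points m L n s B c D"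
proof -
  let ?M = "mspace m" and ?d = "mdist m"
  \<comment> \<open>Scale \<open>L + s\<close> instead of \<open>L\<close> bounds at once the
    elements met by the \<open>L\<close>-balls around all points within \<open>s\<close> of
    \<open>x\<close>.\<close>
  obtain \<U> D0 where cov: "\<Union>\<U> = ?M"
    and D0: "\<And>U x y. U \<in> \<U> \<Longrightarrow> x \<in> U \<Longrightarrow> y \<in> U \<Longrightarrow> ?d x y \<le> D0"
    and mult: "\<And>x. x \<in> ?M \<Longrightarrow> finite {U\<in>\<U>. U \<inter> mcball_of m x (L + s) \<noteq> {}} \<and>
                    card {U\<in>\<U>. U \<inter> mcball_of m x (L + s) \<noteq> {}} \<le> n + 2"
  proof -
    have "L + s > 0" using assms by simp
    from assms(1)[unfolded asdim_le_def, rule_format, OF this]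
    obtain \<U> where \<U>: "uniformly_bounded_cover m \<U>"
      "\<forall>x\<in>?M. finite {U\<in>\<U>. U \<inter> mcball_of m x (L + s) \<noteq> {}} \<and>
              card {U\<in>\<U>. U \<inter> mcball_of m x (L + s) \<noteq> {}} \<le> Suc n + 1" by (elim exE conjE)
    from \<U>(1) obtain D where D: "\<Union>\<U> = ?M" "\<forall>U\<in>\<U>. \<forall>x\<in>U. \<forall>y\<in>U. ?d x y \<le> D"
      unfolding uniformly_bounded_cover_def by (elim exE conjE)
    show thesis
      by (rule that[of \<U> D]) (use D \<U>(2) in simp_all)
  qed
  define E where "E = max D0 0"
  have E: "?d x y \<le> E" if "U \<in> \<U>" "x \<in> U" "y \<in> U" for U x y
    using D0[OF that] by (simp add: E_def)
  have E_nn: "E \<ge> 0" by (simp add: E_def)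
  define met where "met x r = {U\<in>\<U>. U \<inter> mcball_of m x r \<noteq> {}}" for x r
  have in_met: "U \<in> met x r \<longleftrightarrow> U \<in> \<U> \<and> x \<in> ?M \<and> (\<exists>u\<in>U. u \<in> ?M \<and> ?d x u \<le> r)" for U x r
    by (auto simp: met_def)
  have met_mono: "met y r \<subseteq> met x t" if "x \<in> ?M" "?d x y + r \<le> t" for x y r t
  proof
    fix U assume "U \<in> met y r"
    then obtain u where u: "U \<in> \<U>" "u \<in> U" "y \<in> ?M" "u \<in> ?M" "?d y u \<le> r"
      by (auto simp: met_def)
    then have "?d x u \<le> t"
      using mdist_triangle[of x m y u] that by linarith
    then show "U \<in> met x t"
      using u that by (auto simp: met_def)
  qed
  have met_Ls: "finite (met x (L + s))" "card (met x (L + s)) \<le> n + 2" "met x L \<subseteq> met x (L + s)"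
    if "x \<in> ?M" for x
    using mult[OF that] met_mono[OF that, of x L "L + s"] that assms(3) by (simp_all add: met_def)
  have fin: "finite (met x L)" and le: "card (met x L) \<le> n + 2" if "x \<in> ?M" for x
    using met_Ls[OF that] by (meson card_mono finite_subset le_trans)+
  define B where "B = {x \<in> ?M. card (met x L) = n + 2}"
  \<comment> \<open>Both sets have \<open>n + 2\<close> elements and lie in
    \<open>met x (L + s)\<close>, which has no more, so both equal it.\<close>
  have same: "met x L = met y L" if "x \<in> B" "y \<in> B" "?d x y \<le> s" for x y
  proof -
    have M: "x \<in> ?M" "y \<in> ?M" using that by (auto simp: B_def)
    have "met x L \<subseteq> met x (L + s)" "met y L \<subseteq> met x (L + s)"
      using met_Ls(3)[OF M(1)] met_mono[OF M(1), of y L "L + s"] that by simp_all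
    then have "met x L = met x (L + s)" "met y L = met x (L + s)"
      using that by (auto intro!: card_seteq[OF met_Ls(1)[OF M(1)]] order_trans[OF met_Ls(2)[OF M(1)]]
          simp: B_def)
    then show ?thesis by simp
  qed
  have bdd: "?d x y \<le> 2 * L + E" if "x \<in> B" "y \<in> B" "met x L = met y L" for x y
  proof -
    have "met x L \<noteq> {}" using that by (auto simp: B_def)
    then obtain U where "U \<in> met x L" by blast
    moreover from this have "U \<in> met y L" using that(3) by simp
    ultimately obtain u v where uv: "U \<in> \<U>" "u \<in> U" "v \<in> U" "x \<in> ?M" "y \<in> ?M" "u \<in> ?M" "v \<in> ?M"
      "?d x u \<le> L" "?d y v \<le> L" unfolding in_met by blast
    then show ?thesis
      using mdist_triangle[of x m u y] mdist_triangle[of u m v y] E[of U u v]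
        mdist_commute[of m v y] by linarith
  qed
  have key: "asdim_le_at (submetric m Y) L n"
    if Y: "Y \<subseteq> ?M" and p: "p \<in> ?M" and r: "\<forall>x\<in>Y \<inter> B. ?d p x \<le> r" for Y p r
  proof -
    \<comment> \<open>The radius \<open>r + L\<close> puts every element met by the
      \<open>L\<close>-ball of a bad point of \<open>Y\<close> into \<open>Big\<close>. All of
      \<open>Big\<close> stays near \<open>p\<close>, so merging it keeps the cover uniformly
      bounded.\<close>
    define Big where "Big = met p (r + L)"
    define f where "f U = (if U \<in> Big then \<Union>Big \<inter> Y else U \<inter> Y)" for U
    have Big: "Big \<subseteq> \<U>" by (auto simp: Big_def in_met)
    have un: "\<Union>(f ` \<U>) = Y"
    proof
      show "\<Union>(f ` \<U>) \<subseteq> Y" by (auto simp: f_def)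
      show "Y \<subseteq> \<Union>(f ` \<U>)"
      proof
        fix x assume x: "x \<in> Y"
        then obtain U where "U \<in> \<U>" "x \<in> U" using cov Y by blast
        then show "x \<in> \<Union>(f ` \<U>)" using x by (intro UN_I[of U]) (auto simp: f_def)
      qed
    qed
    \<comment> \<open>\<open>r\<close> may be negative when \<open>Y\<close> has no bad
      points.\<close>
    define t where "t = max (r + L) 0"
    have near: "?d p x \<le> t + E" if x: "x \<in> \<Union>Big" for x
    proof -
      obtain U u where U: "U \<in> \<U>" "x \<in> U" "u \<in> U" "u \<in> ?M" "?d p u \<le> r + L"
        using x by (auto simp: Big_def in_met)
      then have "x \<in> ?M" using cov by blast
      then show ?thesis
        using mdist_triangle[of p m u x] E[of U u x] U p by (simp add: t_def)
    qed
    have bd: "?d x y \<le> 2 * (t + E)" if "U \<in> \<U>" "x \<in> f U" "y \<in> f U" for U x y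
    proof (cases "U \<in> Big")
      case True
      then have xy: "x \<in> \<Union>Big" "y \<in> \<Union>Big" "x \<in> ?M" "y \<in> ?M"
        using that Y by (auto simp: f_def)
      then show ?thesis
        using near[OF xy(1)] near[OF xy(2)] mdist_triangle[OF xy(3) p xy(4)] mdist_commute[of m x p]
        by simp
    next
      case False
      then have "?d x y \<le> E" using E that by (auto simp: f_def)
      moreover have "t \<ge> 0" by (simp add: t_def)
      ultimately show ?thesis using E_nn by simp
    qed
    have "uniformly_bounded_cover (submetric m Y) (f ` \<U>)"
      unfolding uniformly_bounded_cover_def using un bd Y
      by (auto simp: Int_absorb2 intro!: exI[of _ "2 * (t + E)"])
    moreover have "finite {W\<in>f ` \<U>. W \<inter> mcball_of (submetric m Y) x L \<noteq> {}} \<and>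
        card {W\<in>f ` \<U>. W \<inter> mcball_of (submetric m Y) x L \<noteq> {}} \<le> n + 1" if "x \<in> Y" for x
    proof -
      have xM: "x \<in> ?M" using that Y by blast
      have sub: "{W\<in>f ` \<U>. W \<inter> mcball_of (submetric m Y) x L \<noteq> {}} \<subseteq> f ` met x L"
      proof
        fix W assume "W \<in> {W\<in>f ` \<U>. W \<inter> mcball_of (submetric m Y) x L \<noteq> {}}"
        then obtain U where U0: "U \<in> \<U>" "W = f U" "f U \<inter> mcball_of (submetric m Y) x L \<noteq> {}" by blast
        then obtain w where "w \<in> f U" "w \<in> mcball_of (submetric m Y) x L" by blast
        with U0 have U: "U \<in> \<U>" "W = f U" "w \<in> f U" "w \<in> ?M" "?d x w \<le> L" by auto
        \<comment> \<open>If \<open>U\<close> was merged, the ball may miss \<open>U\<close> itself,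
          but it meets some element of \<open>Big\<close> with the same image.\<close>
        show "W \<in> f ` met x L"
        proof (cases "U \<in> Big")
          case True
          then obtain U' where U': "U' \<in> Big" "w \<in> U'" using U by (auto simp: f_def)
          then have "U' \<in> met x L" using U Big xM by (auto simp: in_met)
          moreover have "W = f U'" using U U' True by (simp add: f_def)
          ultimately show ?thesis by blast
        next
          case False
          then have "U \<in> met x L" using U xM by (auto simp: in_met f_def)
          then show ?thesis using U by blast
        qed
      qed
      \<comment> \<open>Around a bad point all elements met have merged into one; around any other
        point there were at most \<open>n + 1\<close> to begin with.\<close>
      have "card (f ` met x L) \<le> n + 1"
      proof (cases "x \<in> B")
        case True
        then have "?d p x \<le> r" using r that by blast
        then have "met x L \<subseteq> Big"
          unfolding Big_def using met_mono p by simp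
        then have "f ` met x L \<subseteq> {\<Union>Big \<inter> Y}" by (auto simp: f_def)
        then have "card (f ` met x L) \<le> card {\<Union>Big \<inter> Y}" by (intro card_mono) auto
        then show ?thesis by simp
      next
        case False
        then have "card (met x L) \<le> n + 1" using le[OF xM] xM by (auto simp: B_def)
        then show ?thesis using card_image_le[OF fin[OF xM], of f] by linarith
      qed
      then show ?thesis
        using sub fin[OF xM] by (meson card_mono finite_imageI finite_subset le_trans)
    qed
    ultimately show ?thesis
      using Y unfolding asdim_le_at_def by (auto simp: Int_absorb2)
  qed
  have "bad_points m L n s B (\<lambda>x. met x L) (2 * L + E)"
    unfolding bad_points_def
  proof (intro conjI ballI allI impI)
    show "2 * L + E \<ge> 0" using E_nn assms by simp
    show "B \<subseteq> ?M" by (auto simp: B_def)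
  qed (fact same bdd key)+
  then show ?thesis by blast
qed

text \<open>A process running downwards through all scales has no first step. Finite chains replace
  it: a chain starts in \<open>T\<close> at any level, and a jump by \<open>J k\<close> leads from
  level \<open>Suc k\<close> to level \<open>k\<close>.\<close>

inductive descend :: "(nat \<Rightarrow> 'a \<Rightarrow> 'a \<Rightarrow> bool) \<Rightarrow> 'a set \<Rightarrow> nat \<Rightarrow> 'a \<Rightarrow> bool" for J T where
  start: "x \<in> T \<Longrightarrow> descend J T k x"
| step: "descend J T (Suc k) y \<Longrightarrow> J k y x \<Longrightarrow> descend J T k x"

text \<open>\<open>T\<close> is enlarged by absorbing, from large scales to small ones, the bounded clusters of bad points
  that it comes close to; a cluster of scale \<open>k\<close> is only considered at distance \<open>r k\<close> from \<open>p\<close>, so that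
  the enlargement is small compared to the distance from \<open>p\<close>. The scales grow so fast that the later
  steps do not reach further clusters of an earlier scale.\<close>

lemma small_frontier_exists:
  assumes asdim: "asdim_le m (Suc n)" and T: "T \<subseteq> mspace m" and p: "p \<in> mspace m"
  obtains A where "T \<subseteq> A" "A \<subseteq> mspace m" "\<And>x. x \<in> A \<Longrightarrow> \<exists>a\<in>T. 4 * mdist m x a \<le> mdist m p a"
    "asdim_le (submetric m {x \<in> A. \<exists>y \<in> mspace m - A. mdist m x y \<le> 1}) n"
proof -
  let ?M = "mspace m" and ?d = "mdist m"
  have "\<forall>L s. \<exists>B (c :: 'a \<Rightarrow> 'a set set) D. L > 0 \<and> s \<ge> 0 \<longrightarrow> bad_points m L n s B c D"
    using bad_points_exist[OF asdim] by blast
  then obtain B0 and c0 :: "real \<Rightarrow> real \<Rightarrow> 'a \<Rightarrow> 'a set set" and D0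
    where 0: "\<And>L s. L > 0 \<Longrightarrow> s \<ge> 0 \<Longrightarrow> bad_points m L n s (B0 L s) (c0 L s) (D0 L s)"
    by metis
  \<comment> \<open>A jump at scale \<open>k\<close> takes at most \<open>e k\<close> to reach a
    cluster, \<open>D k\<close> across it and 1 beyond it; \<open>e (Suc k) - e k\<close> is exactly
    this sum. \<open>D k\<close> depends only on \<open>k\<close> and \<open>e k\<close>, so the
    recursion is well-founded.\<close>
  define e where "e = rec_nat 1 (\<lambda>k x. 2 * x + D0 (real (Suc k)) (x + 1) + 1)"
  define B where "B k = B0 (real (Suc k)) (e k + 1)" for k
  define c where "c k = c0 (real (Suc k)) (e k + 1)" for k
  define D where "D k = D0 (real (Suc k)) (e k + 1)" for k
  have e_0: "e 0 = 1" and e_Suc: "e (Suc k) = 2 * e k + D k + 1" for k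
    by (simp_all add: e_def D_def)
  have e_ge1: "e k \<ge> 1" for k
  proof (induction k)
    case (Suc k)
    then have "D k \<ge> 0" using 0[of "real (Suc k)" "e k + 1"] by (simp add: D_def bad_points_def)
    then show ?case using Suc by (simp add: e_Suc)
  qed (simp add: e_0)
  have bad: "bad_points m (real (Suc k)) n (e k + 1) (B k) (c k) (D k)" for k
    using 0[of "real (Suc k)" "e k + 1"] e_ge1[of k] unfolding B_def c_def D_def by simp
  have D_nn: "D k \<ge> 0" and B_sub: "B k \<subseteq> ?M"
    and same: "\<And>x y. x \<in> B k \<Longrightarrow> y \<in> B k \<Longrightarrow> ?d x y \<le> e k + 1 \<Longrightarrow> c k x = c k y"
    and bdd: "\<And>x y. x \<in> B k \<Longrightarrow> y \<in> B k \<Longrightarrow> c k x = c k y \<Longrightarrow> ?d x y \<le> D k" for k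
    using bad[of k] unfolding bad_points_def by simp_all
  have mult: "asdim_le_at (submetric m Y) (real (Suc k)) n"
    if "Y \<subseteq> ?M" "\<forall>x\<in>Y \<inter> B k. ?d p x \<le> r" for Y k r
    using bad[of k] that p unfolding bad_points_def by blast
  \<comment> \<open>A point within \<open>e k\<close> of one farther than \<open>r k\<close> from
    \<open>p\<close> is itself at distance at least \<open>4 * e (Suc k)\<close> from
    \<open>p\<close>; this yields the factor 4 in the conclusion.\<close>
  define r where "r k = 4 * e (Suc k) + e k" for k
  \<comment> \<open>Jumps reach everything within 1 of the cluster, so that its unit neighbourhood
    is absorbed with it. The case \<open>x = y\<close> lets a chain pass a level unchanged.\<close>
  define J where "J k y x \<longleftrightarrow> x \<in> ?M \<and> (x = y \<or>
      (\<exists>q\<in>B k. \<exists>q'\<in>B k. c k q = c k q' \<and> ?d p q > r k \<and> ?d y q \<le> e k \<and> ?d x q' \<le> 1))" for k y x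
  define Acc where "Acc = descend J T"
  have Acc_sub: "Acc k x \<Longrightarrow> x \<in> ?M" for k x
    unfolding Acc_def by (erule descend.cases) (use T in \<open>auto simp: J_def\<close>)
  have J_dist: "?d x y \<le> e (Suc k) - e k" if J: "J k y x" and y: "y \<in> ?M" for k x y
  proof (cases "x = y")
    case True
    then show ?thesis using that D_nn[of k] e_ge1[of k] by (simp add: e_Suc)
  next
    case False
    then obtain q q' where q: "q \<in> B k" "q' \<in> B k" "c k q = c k q'" "?d y q \<le> e k" "?d x q' \<le> 1"
      using J by (auto simp: J_def)
    then have M: "q \<in> ?M" "q' \<in> ?M" "x \<in> ?M" using B_sub J by (auto simp: J_def)
    then show ?thesis
      using q bdd[OF q(2,1)] mdist_triangle[OF M(3,2) y] mdist_triangle[OF M(2,1) y]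
        mdist_commute[of m q y] by (simp add: e_Suc)
  qed
  \<comment> \<open>The jumps at scales below \<open>k\<close> have total length at most
    \<open>e k - e 0\<close>, and points of \<open>T\<close> belong to every level.\<close>
  have Acc_near: "\<exists>y. Acc k y \<and> ?d x y \<le> e k" if "Acc 0 x" for x k
  proof (induction k)
    case 0
    then show ?case using that Acc_sub[OF that] by (intro exI[of _ x]) (simp add: e_0)
  next
    case (Suc k)
    then obtain y where y: "Acc k y" "?d x y \<le> e k" by blast
    from y(1) show ?case unfolding Acc_def
    proof (cases rule: descend.cases)
      case start
      then show "\<exists>y. descend J T (Suc k) y \<and> ?d x y \<le> e (Suc k)" using y(2) D_nn[of k] e_ge1[of k]
        by (intro exI[of _ y]) (auto simp: e_Suc intro: descend.start)
    next
      case (step z)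
      then have z: "Acc (Suc k) z" "z \<in> ?M" using Acc_sub by (auto simp: Acc_def)
      have "?d y z \<le> e (Suc k) - e k" using J_dist step z by blast
      then have "?d x z \<le> e (Suc k)"
        using y mdist_triangle[of x m y z] Acc_sub that y(1) z by fastforce
      then show "\<exists>y. descend J T (Suc k) y \<and> ?d x y \<le> e (Suc k)"
        using z by (auto simp: Acc_def)
    qed
  qed
  have Acc_drop: "Acc 0 x" if "Acc k x" for k x
    using that
  proof (induction k)
    case (Suc k)
    then have "Acc k x"
      using descend.step[of J T k x x] Acc_sub[OF Suc.prems] by (simp add: Acc_def J_def)
    then show ?case using Suc by blast
  qed
  have e_mono: "e k \<le> e (Suc k)" for k using D_nn[of k] e_ge1[of k] by (simp add: e_Suc)
  \<comment> \<open>Here \<open>a\<close> is a point of \<open>T\<close> on the chain and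
    \<open>j\<close> the scale of the first proper jump after it: \<open>r j\<close> puts
    \<open>a\<close> far from \<open>p\<close>, and the lengths telescope.\<close>
  have Acc_T: "x \<in> T \<or> (\<exists>j\<ge>k. \<exists>a\<in>T. ?d p a \<ge> 4 * e (Suc j) \<and> ?d x a \<le> e (Suc j) - e k)"
    if "Acc k x" for k x
    using that unfolding Acc_def
  proof (induction rule: descend.induct)
    case (step k y x)
    have y: "y \<in> ?M" using step Acc_sub by (auto simp: Acc_def)
    have x: "x \<in> ?M" using step by (auto simp: J_def)
    have dxy: "?d x y \<le> e (Suc k) - e k" using J_dist step y by blast
    show ?case
    proof (cases "x = y")
      case True
      have "e (Suc j) - e (Suc k) \<le> e (Suc j) - e k" for j
        using e_mono[of k] by simp
      then show ?thesis using step.IH True by (meson Suc_leD order_trans)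
    next
      case False
      then obtain q where q: "q \<in> B k" "?d p q > r k" "?d y q \<le> e k"
        using step by (auto simp: J_def)
      then have py: "?d p y \<ge> 4 * e (Suc k)"
        using mdist_triangle[of p m y q] p y B_sub[of k] by (auto simp: r_def)
      show ?thesis
        using step.IH
      proof
        assume "y \<in> T"
        then show ?thesis using py dxy by blast
      next
        assume "\<exists>j\<ge>Suc k. \<exists>a\<in>T. 4 * e (Suc j) \<le> ?d p a \<and> ?d y a \<le> e (Suc j) - e (Suc k)"
        then obtain j a where ja: "j \<ge> Suc k" "a \<in> T" "4 * e (Suc j) \<le> ?d p a"
          "?d y a \<le> e (Suc j) - e (Suc k)" by blast
        then have "?d x a \<le> e (Suc j) - e k"
          using mdist_triangle[of x m y a] x y T dxy by auto
        then show ?thesis using ja by (meson Suc_leD)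
      qed
    qed
  qed simp
  define A where "A = {x. Acc 0 x}"
  define Y where "Y = {x \<in> A. \<exists>y \<in> ?M - A. ?d x y \<le> 1}"
  \<comment> \<open>A frontier point \<open>x\<close> has some \<open>z\<close> outside
    \<open>A\<close> within 1. If \<open>x\<close> were a bad point of scale \<open>k\<close> far
    from \<open>p\<close>, its cluster would be within reach of a point of level
    \<open>Suc k\<close>, and \<open>z\<close> would have been absorbed.\<close>
  have Y_bad: "?d p x \<le> r k" if xY: "x \<in> Y \<inter> B k" for x k
  proof (rule ccontr)
    assume far: "\<not> ?d p x \<le> r k"
    obtain z where z: "Acc 0 x" "z \<in> ?M" "\<not> Acc 0 z" "?d x z \<le> 1"
      using xY by (auto simp: Y_def A_def)
    have x: "x \<in> B k" "x \<in> ?M" using xY B_sub by auto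
    obtain y where y: "Acc k y" "?d x y \<le> e k" using Acc_near[OF z(1)] by blast
    have yM: "y \<in> ?M" using Acc_sub y by blast
    have zx: "?d z x \<le> 1" and yx: "?d y x \<le> e k"
      using z y mdist_commute[of m] by metis+
    have "\<exists>w. Acc (Suc k) w \<and> J k w z"
      using y(1) unfolding Acc_def
    proof (cases rule: descend.cases)
      case start
      then show "\<exists>w. descend J T (Suc k) w \<and> J k w z"
        using x far yx zx z(2) by (intro exI[of _ y]) (auto simp: J_def intro!: descend.start)
    next
      case (step w)
      have "J k w z"
      proof (cases "y = w")
        case True
        then show ?thesis using x far yx zx z(2) by (auto simp: J_def)
      next
        case False
        then obtain q q' where q: "q \<in> B k" "q' \<in> B k" "c k q = c k q'" "?d p q > r k"
          "?d w q \<le> e k" "?d y q' \<le> 1"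
          using step by (auto simp: J_def)
        then have "q' \<in> ?M" using B_sub by blast
        \<comment> \<open>The separation \<open>e k + 1\<close> is made for this bound:
          \<open>q'\<close> and \<open>x\<close> lie in one cluster, so the jump from
          \<open>w\<close> could have led to \<open>z\<close>.\<close>
        then have "?d x q' \<le> e k + 1"
          using mdist_triangle[of x m y q'] x yM y q by auto
        then have "c k q = c k x" using same[OF x(1) q(2)] q(3) by simp
        then show ?thesis using q x zx z(2) by (auto simp: J_def)
      qed
      then show "\<exists>w. descend J T (Suc k) w \<and> J k w z" using step by blast
    qed
    then have "Acc k z" unfolding Acc_def by (blast intro: descend.step)
    then show False using Acc_drop z by blast
  qed
  show thesis
  proof
    show "T \<subseteq> A" by (auto simp: A_def Acc_def intro: descend.start)
    show "A \<subseteq> ?M" using Acc_sub by (auto simp: A_def)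
    show "\<exists>a\<in>T. 4 * ?d x a \<le> ?d p a" if "x \<in> A" for x
    proof -
      have "Acc 0 x" using that by (simp add: A_def)
      from Acc_T[OF this] show ?thesis
      proof
        assume "x \<in> T"
        then show ?thesis using T by (intro bexI[of _ x]) auto
      next
        assume "\<exists>j\<ge>0. \<exists>a\<in>T. 4 * e (Suc j) \<le> ?d p a \<and> ?d x a \<le> e (Suc j) - e 0"
        then show ?thesis using e_0 by force
      qed
    qed
    have YM: "Y \<subseteq> ?M" using Acc_sub by (auto simp: Y_def A_def)
    show "asdim_le (submetric m {x \<in> A. \<exists>y \<in> ?M - A. ?d x y \<le> 1}) n"
      unfolding asdim_le_iff_at Y_def[symmetric]
    proof (intro allI impI)
      fix R :: real assume "R > 0"
      obtain k where "R \<le> real k" using real_arch_simple by blast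
      moreover have "asdim_le_at (submetric m Y) (real (Suc k)) n"
        using mult[OF YM] Y_bad by blast
      ultimately show "asdim_le_at (submetric m Y) R n"
        by (elim asdim_le_at_mono) simp
    qed
  qed
qed

section \<open>Coarse separation along an isometric line\<close>

lemma nbhdI: "x \<in> mspace m \<Longrightarrow> a \<in> A \<Longrightarrow> mdist m x a \<le> R \<Longrightarrow> x \<in> nbhd m R A"
  unfolding nbhd_def by (auto intro!: cINF_lower2 bdd_belowI2[of _ 0])

text \<open>The infimum may not be attained, so membership yields no point of \<open>A\<close>
  within \<open>R\<close>; only lower bounds for all distances can be compared with
  \<open>R\<close>.\<close>

lemma nbhdD: "x \<in> nbhd m R A \<Longrightarrow> (\<And>a. a \<in> A \<Longrightarrow> c \<le> mdist m x a) \<Longrightarrow> c \<le> R"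
  unfolding nbhd_def using cINF_greatest[of A c "mdist m x"] by force

text \<open>A connected set that avoids the 1-neighbourhood of the frontier of \<open>A\<close> cannot leave \<open>A\<close>, since
  the distance of its points in \<open>A\<close> to the complement of \<open>A\<close> is more than 1.\<close>

lemma connectedin_off_frontier:
  assumes Y: "Y = {x \<in> A. \<exists>y \<in> mspace m - A. mdist m x y \<le> 1}" and A: "A \<subseteq> mspace m"
    and C: "connectedin (subtopology (mtopology_of m) (mspace m - nbhd m 1 Y)) C"
  shows "C \<subseteq> A \<or> C \<inter> A = {}"
proof -
  let ?M = "mspace m" and ?d = "mdist m"
  define U where "U = ?M - nbhd m 1 Y"
  define X where "X = subtopology (mtopology_of m) U"
  interpret Metric_space ?M ?d by blast
  have topX: "topspace X = U" by (auto simp: X_def U_def)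
  have offY: "x \<notin> Y \<and> (\<forall>y\<in>Y. ?d x y > 1)" if "x \<in> U" for x
  proof -
    have "?d x y > 1" if "y \<in> Y" for y
      using nbhdI[of x m y Y 1] \<open>x \<in> U\<close> that by (force simp: U_def)
    moreover have "x \<in> ?M" using that by (simp add: U_def)
    ultimately show ?thesis by force
  qed
  \<comment> \<open>A subset of \<open>U\<close> that steps of length at most 1 within
    \<open>U\<close> cannot leave is open; \<open>A \<inter> U\<close> and \<open>U - A\<close> are
    both of this kind.\<close>
  have open_if: "openin X S" if S: "S \<subseteq> U" and "\<And>x y. x \<in> S \<Longrightarrow> y \<in> U \<Longrightarrow> ?d x y \<le> 1 \<Longrightarrow> y \<in> S" for S
  proof (subst openin_subopen, intro ballI)
    fix x assume x: "x \<in> S"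
    have "openin X (mball x 1 \<inter> U)"
      unfolding X_def by (rule openin_subtopology_Int) (simp add: mtopology_of_def)
    moreover have "x \<in> mball x 1 \<inter> U" using x S by (auto simp: U_def)
    moreover have "mball x 1 \<inter> U \<subseteq> S" using that(2)[OF x] by auto
    ultimately show "\<exists>T. openin X T \<and> x \<in> T \<and> T \<subseteq> S" by blast
  qed
  have sep: "y \<in> A \<longleftrightarrow> x \<in> A" if "x \<in> U" "y \<in> U" "?d x y \<le> 1" for x y
  proof -
    have *: False if "x \<in> U" "y \<in> U" "?d x y \<le> 1" "x \<in> A" "y \<notin> A" for x y
    proof -
      have "y \<in> ?M" using that by (simp add: U_def)
      then have "x \<in> Y" using that by (auto simp: Y)
      then show False using offY that by blast
    qed
    show ?thesis using *[of x y] *[of y x] that mdist_commute[of m x y] by auto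
  qed
  have "openin X (A \<inter> U)" "openin X (U - A)"
    by (rule open_if; use sep in blast)+
  moreover have "topspace X - (A \<inter> U) = U - A" using topX by blast
  ultimately have "openin X (A \<inter> U)" "closedin X (A \<inter> U)"
    by (auto simp: closedin_def topX)
  then have "C \<subseteq> A \<inter> U \<or> disjnt C (A \<inter> U)"
    using connectedin_clopen_cases C unfolding X_def U_def by blast
  moreover have "C \<subseteq> U"
    using connectedin_subset_topspace[OF C] by (auto simp: U_def)
  ultimately show ?thesis by (auto simp: disjnt_def)
qed

text \<open>The set \<open>T\<close> is a cone around the positive ray; the negative ray stays linearly far away from
  everything that is close to the cone on the scale of the distance from the apex.\<close>

lemma isometric_line_coarsely_separated:
  fixes \<gamma> :: "real \<Rightarrow> 'a"
  assumes asdim: "asdim_le m (Suc n)" and \<gamma>: "\<And>t. \<gamma> t \<in> mspace m"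
    and iso: "\<And>s t. mdist m (\<gamma> s) (\<gamma> t) = \<bar>s - t\<bar>"
  obtains Y where "Y \<subseteq> mspace m" "coarsely_separates m Y" "asdim_le (submetric m Y) n"
proof -
  let ?M = "mspace m" and ?d = "mdist m"
  define T where "T = {x \<in> ?M. \<exists>t\<ge>1. ?d (\<gamma> t) x \<le> t / 4}"
  have TM: "T \<subseteq> ?M" by (auto simp: T_def)
  obtain A where TA: "T \<subseteq> A" and AM: "A \<subseteq> ?M"
    and near: "\<And>x. x \<in> A \<Longrightarrow> \<exists>a\<in>T. 4 * ?d x a \<le> ?d (\<gamma> 0) a"
    and asdimY: "asdim_le (submetric m {x \<in> A. \<exists>y \<in> ?M - A. ?d x y \<le> 1}) n"
    by (rule small_frontier_exists[OF asdim TM \<gamma>[of 0]]) (rule that)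
  define Y where "Y = {x \<in> A. \<exists>y \<in> ?M - A. ?d x y \<le> 1}"
  have YA: "Y \<subseteq> A" by (auto simp: Y_def)
  have pos: "t / 4 - 1 \<le> ?d (\<gamma> t) y" if t: "t \<ge> 1" and y: "y \<in> Y" for t y
  proof -
    obtain z where z: "z \<in> ?M" "z \<notin> A" "?d y z \<le> 1" using y by (auto simp: Y_def)
    then have "z \<notin> T" using TA by blast
    then have "?d (\<gamma> t) z > t / 4" using z t by (force simp: T_def)
    moreover have "y \<in> ?M" using y YA AM by blast
    ultimately show ?thesis using mdist_triangle[OF \<gamma>[of t] \<open>y \<in> ?M\<close> z(1)] z(3) by simp
  qed
  \<comment> \<open>With \<open>a\<close> in the cone at height \<open>s\<close>, \<open>x\<close>
    is at most \<open>5 * s / 16\<close> from \<open>a\<close>, hence \<open>9 * s / 16\<close> from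
    \<open>\<gamma> s\<close>, while \<open>\<gamma> (- t)\<close> is \<open>t + s\<close> away from
    \<open>\<gamma> s\<close>.\<close>
  have neg: "t \<le> ?d (\<gamma> (- t)) x" if t: "t \<ge> 0" and x: "x \<in> A" for t x
  proof -
    obtain a where a: "a \<in> T" "4 * ?d x a \<le> ?d (\<gamma> 0) a" using near x by blast
    then obtain s where s: "s \<ge> 1" "?d (\<gamma> s) a \<le> s / 4" "a \<in> ?M" by (auto simp: T_def)
    have xM: "x \<in> ?M" using x AM by blast
    show ?thesis
      using mdist_triangle[OF \<gamma>[of "- t"] xM \<gamma>[of s]] mdist_triangle[OF xM s(3) \<gamma>[of s]]
        mdist_triangle[OF \<gamma>[of 0] \<gamma>[of s] s(3)] mdist_commute[of m a "\<gamma> s"] iso[of "- t" s] iso[of 0 s] a s t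
      by simp
  qed
  \<comment> \<open>The bound on \<open>t\<close> gives \<open>t / 4 - 1 > R\<close>. For
    \<open>R = 1\<close> it is 9, where both rays below start.\<close>
  have far: "\<gamma> t \<notin> nbhd m R Y" "\<gamma> (- t) \<notin> nbhd m R Y" if "R > 0" "t \<ge> 4 * R + 5" for R t
    using nbhdD[of "\<gamma> t" m R Y "t / 4 - 1"] pos[of t] nbhdD[of "\<gamma> (- t)" m R Y t] neg[of t] that YA
    by fastforce+
  define U where "U = ?M - nbhd m 1 Y"
  define X where "X = subtopology (mtopology_of m) U"
  have ray: "connectedin X (\<gamma> ` S)" if "connected S" "\<gamma> ` S \<subseteq> U" for S
  proof -
    have "Lipschitz_continuous_map euclidean_metric m \<gamma>"
      using \<gamma> iso by (auto simp: Lipschitz_continuous_map_def dist_real_def intro!: exI[of _ 1])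
    then have "continuous_map euclidean (mtopology_of m) \<gamma>"
      using Lipschitz_continuous_imp_continuous_map by fastforce
    then have "connectedin (mtopology_of m) (\<gamma> ` S)"
      using connectedin_continuous_map_image that by fastforce
    then show ?thesis using that by (simp add: X_def connectedin_subtopology)
  qed
  have U: "\<gamma> t \<in> U" "\<gamma> (- t) \<in> U" if "t \<ge> 9" for t
    using far[of 1 t] that \<gamma> by (auto simp: U_def)
  have comp: "connected_component_of_set X x \<in> connected_components_of X" if "x \<in> U" for x
    using that by (auto simp: connected_component_in_connected_components_of X_def U_def)
  define C where "C = connected_component_of_set X (\<gamma> 9)"
  define D where "D = connected_component_of_set X (\<gamma> (- 9))"
  have C: "\<gamma> t \<in> C" if "t \<ge> 9" for t
    using connected_component_of_maximal[OF ray[of "{9..}"], of "\<gamma> 9"] U that by (auto simp: C_def)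
  have D: "\<gamma> (- t) \<in> D" if "t \<ge> 9" for t
  proof -
    have "\<gamma> ` {..- 9} \<subseteq> U" using U(2)[of "- t" for t] by force
    then have "\<gamma> ` {..- 9} \<subseteq> D"
      unfolding D_def by (intro connected_component_of_maximal ray) auto
    then show ?thesis using that by auto
  qed
  \<comment> \<open>A common component would contain \<open>\<gamma> 9\<close>, which lies in the
    cone, and \<open>\<gamma> (- 9)\<close>, which \<open>neg\<close> keeps out of
    \<open>A\<close>.\<close>
  have "C \<noteq> D"
  proof
    assume "C = D"
    moreover have "connectedin X C" by (simp add: C_def connectedin_connected_component_of)
    then have "C \<subseteq> A \<or> C \<inter> A = {}"
      using connectedin_off_frontier[OF Y_def AM] unfolding X_def U_def by blast
    moreover have "\<gamma> 9 \<in> T"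
      using \<gamma> by (auto simp: T_def iso intro!: exI[of _ 9])
    moreover have "\<gamma> (- 9) \<notin> A"
      using neg[of 9 "\<gamma> (- 9)"] \<gamma> by auto
    ultimately show False using C[of 9] D[of 9] TA by auto
  qed
  moreover have "deep m Y C"
    unfolding deep_def
  proof (intro allI impI)
    fix R :: real assume "R > 0"
    then show "\<not> C \<subseteq> nbhd m R Y" using far(1)[of R "4 * R + 9"] C[of "4 * R + 9"] by auto
  qed
  moreover have "deep m Y D"
    unfolding deep_def
  proof (intro allI impI)
    fix R :: real assume "R > 0"
    then show "\<not> D \<subseteq> nbhd m R Y" using far(2)[of R "4 * R + 9"] D[of "4 * R + 9"] by auto
  qed
  moreover have "{C, D} \<subseteq> connected_components_of (subtopology (mtopology_of m) (?M - nbhd m 1 Y))"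
    using comp U[of 9] by (simp add: C_def D_def X_def U_def)
  ultimately have "coarsely_separates m Y"
    unfolding coarsely_separates_def using YA AM zero_less_one by blast
  then show thesis
    using that[of Y] YA AM asdimY by (auto simp: Y_def)
qed

section \<open>Geodesic lines in graphs\<close>

lemma finite_relpow_ball:
  fixes E :: "('a \<times> 'a) set"
  assumes "\<And>u. finite (E `` {u})"
  shows "finite {w. (p, w) \<in> E ^^ k}"
proof (induction k)
  case (Suc k)
  have "{w. (p, w) \<in> E ^^ Suc k} = (\<Union>u\<in>{w. (p, w) \<in> E ^^ k}. E `` {u})" by auto
  then show ?case using Suc assms by simp
qed simp

context connected_graph
begin

lemma path_dist_vertices:
  assumes "\<phi> \<in> realization V E" "\<psi> \<in> realization V E" "supp \<phi> = {u}" "supp \<psi> = {v}"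
    and "\<phi> u = 1" "\<psi> v = 1"
  shows "path_dist E \<phi> \<psi> = real (vertex_dist E u v)"
proof (cases "u = v")
  case True
  then show ?thesis using path_dist_same[OF assms(1,2), of u] assms by simp
next
  case False
  then have "supp \<phi> \<noteq> supp \<psi>" using assms by simp
  from path_dist_attained[OF assms(1,2) this] show ?thesis using assms by auto
qed

text \<open>Each interval \<open>[i, i + 1]\<close> runs linearly along the edge from
  \<open>v i\<close> to \<open>v (i + 1)\<close>. Following the line bounds distances from above;
  the exact distances between vertices on either side bound them from below.\<close>

lemma isometric_line_of_geodesic:
  fixes v :: "int \<Rightarrow> 'a"
  assumes vV: "\<And>i. v i \<in> V" and geo: "\<And>i j. vertex_dist E (v i) (v j) = nat \<bar>i - j\<bar>"
  obtains \<gamma> :: "real \<Rightarrow> 'a \<Rightarrow> real" where "\<And>t. \<gamma> t \<in> realization V E"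
    "\<And>s t. mdist (graph_metric V E) (\<gamma> s) (\<gamma> t) = \<bar>s - t\<bar>"
proof -
  define pt :: "int \<Rightarrow> real \<Rightarrow> 'a \<Rightarrow> real" where
    "pt i a = (\<lambda>x. if x = v i then 1 - a else if x = v (i + 1) then a else 0)" for i a
  have inj: "v i = v j \<longleftrightarrow> i = j" for i j
    using geo[of i j] by auto
  have adj: "(v i, v (i + 1)) \<in> E" for i
    using vertex_dist_relpow[OF vV vV, of i "i + 1"] geo[of i "i + 1"] by simp
  have pt_end: "pt i 1 = pt (i + 1) 0" for i
    by (auto simp: pt_def fun_eq_iff inj)
  have supp_pt: "supp (pt i a) = (if a = 0 then {v i} else if a = 1 then {v (i + 1)} else {v i, v (i + 1)})" for i a
    by (auto simp: supp_def pt_def inj)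
  have pt_at: "pt i a (v i) = 1 - a" "pt i a (v (i + 1)) = a" for i a
    by (auto simp: pt_def inj)
  have pt_real: "pt i a \<in> realization V E" if a: "0 \<le> a" "a \<le> 1" for i a
  proof -
    have "\<forall>x. 0 \<le> pt i a x" using a by (auto simp: pt_def)
    moreover have "sum (pt i a) (supp (pt i a)) = 1"
      by (auto simp: supp_pt pt_at inj)
    moreover have "(\<exists>x\<in>V. supp (pt i a) = {x}) \<or> (\<exists>(x, y)\<in>E. supp (pt i a) = {x, y})"
      using vV adj[of i] by (auto simp: supp_pt)
    ultimately show ?thesis by (simp add: realization_def)
  qed
  \<comment> \<open>Parameters 0 and 1 give vertices, whose supports differ from those of interior
    points, so \<open>path_dist\<close> switches formula there.\<close>
  have same_edge: "path_dist E (pt i a) (pt i b) \<le> b - a" if ab: "0 \<le> a" "a \<le> b" "b \<le> 1" for i a b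
  proof -
    have R: "pt i a \<in> realization V E" "pt i b \<in> realization V E" using pt_real ab by auto
    consider "a = b" | "a = 0" "0 < b" "b < 1" | "a = 0" "b = 1" | "0 < a" "a < 1" "b = 1" | "0 < a" "b < 1"
      using ab by linarith
    then show ?thesis
    proof cases
      case 1
      then show ?thesis using path_dist_eq_0_iff[OF R] by simp
    next
      case 2
      then show ?thesis using path_dist_le[OF R, of "v i" "v i"] by (simp add: supp_pt pt_at)
    next
      case 3
      then show ?thesis using path_dist_le[OF R, of "v i" "v (i + 1)"] geo[of i "i + 1"]
        by (simp add: supp_pt pt_at)
    next
      case 4
      then show ?thesis using path_dist_le[OF R, of "v (i + 1)" "v (i + 1)"] by (simp add: supp_pt pt_at)
    next
      case 5
      then show ?thesis using path_dist_same[OF R, of "v i"] ab by (simp add: supp_pt pt_at)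
    qed
  qed
  have vertices: "path_dist E (pt i 0) (pt j 0) = \<bar>i - j\<bar>" for i j
    using path_dist_vertices[OF pt_real[of 0 i] pt_real[of 0 j], of "v i" "v j"] geo[of i j]
    by (simp add: supp_pt pt_at)
  define \<gamma> where "\<gamma> t = pt \<lfloor>t\<rfloor> (frac t)" for t
  have \<gamma>_real: "\<gamma> t \<in> realization V E" for t
    using pt_real frac_lt_1[of t] by (simp add: \<gamma>_def less_imp_le)
  have pt0: "pt i 0 \<in> realization V E" for i by (simp add: pt_real)
  have up: "path_dist E (\<gamma> t) (pt (\<lfloor>t\<rfloor> + 1) 0) \<le> \<lfloor>t\<rfloor> + 1 - t" for t :: real
    using same_edge[of "frac t" 1 "\<lfloor>t\<rfloor>"] frac_lt_1[of t] by (simp add: \<gamma>_def pt_end frac_def)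
  have down: "path_dist E (pt \<lfloor>t\<rfloor> 0) (\<gamma> t) \<le> t - \<lfloor>t\<rfloor>" for t :: real
    using same_edge[of 0 "frac t" "\<lfloor>t\<rfloor>"] frac_lt_1[of t] by (simp add: \<gamma>_def frac_def)
  have upper: "path_dist E (\<gamma> s) (\<gamma> t) \<le> t - s" if st: "s \<le> t" for s t :: real
  proof (cases "\<lfloor>s\<rfloor> = \<lfloor>t\<rfloor>")
    case True
    then have "\<lfloor>t\<rfloor> \<le> s" by linarith
    with True show ?thesis
      using same_edge[of "frac s" "frac t" "\<lfloor>s\<rfloor>"] frac_lt_1[of t] st
      by (simp add: \<gamma>_def frac_def)
  next
    case False
    then have "\<lfloor>s\<rfloor> + 1 \<le> \<lfloor>t\<rfloor>" using floor_mono[OF st] by linarith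
    then have "path_dist E (pt (\<lfloor>s\<rfloor> + 1) 0) (pt \<lfloor>t\<rfloor> 0) = \<lfloor>t\<rfloor> - (\<lfloor>s\<rfloor> + 1)" by (simp add: vertices)
    then show ?thesis
      using path_dist_triangle[OF \<gamma>_real[of s] pt0[of "\<lfloor>s\<rfloor> + 1"] \<gamma>_real[of t]] up[of s] down[of t]
        path_dist_triangle[OF pt0[of "\<lfloor>s\<rfloor> + 1"] pt0[of "\<lfloor>t\<rfloor>"] \<gamma>_real[of t]] by simp
  qed
  \<comment> \<open>The segment is prolonged to the vertices \<open>floor s\<close> and
    \<open>floor t + 1\<close>, whose distance is known exactly; \<open>down\<close> and
    \<open>up\<close> bound the added pieces.\<close>
  have lower: "t - s \<le> path_dist E (\<gamma> s) (\<gamma> t)" if st: "s \<le> t" for s t :: real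
  proof -
    have "path_dist E (pt \<lfloor>s\<rfloor> 0) (pt (\<lfloor>t\<rfloor> + 1) 0) = \<lfloor>t\<rfloor> + 1 - \<lfloor>s\<rfloor>"
      using floor_mono[OF st] by (simp add: vertices)
    then show ?thesis
      using path_dist_triangle[OF pt0[of "\<lfloor>s\<rfloor>"] \<gamma>_real[of s] pt0[of "\<lfloor>t\<rfloor> + 1"]] down[of s] up[of t]
        path_dist_triangle[OF \<gamma>_real[of s] \<gamma>_real[of t] pt0[of "\<lfloor>t\<rfloor> + 1"]] by simp
  qed
  have "mdist (graph_metric V E) (\<gamma> s) (\<gamma> t) = \<bar>s - t\<bar>" for s t
    using upper[of s t] lower[of s t] upper[of t s] lower[of t s] path_dist_sym[OF \<gamma>_real[of s] \<gamma>_real[of t]]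
    by (cases "s \<le> t") (simp_all add: mdist_graph_metric \<gamma>_real)
  with \<gamma>_real show thesis by (rule that)
qed

text \<open>This is compactness: balls are finite, so repeated pigeonholing leaves infinitely many
  centred segments that agree on ever larger intervals, and the common values form the line.\<close>

lemma bi_infinite_geodesic:
  assumes fin: "\<And>u. finite (E `` {u})" and p: "p \<in> V"
    and seg: "\<And>n. \<exists>h :: int \<Rightarrow> 'a. h 0 = p \<and> (\<forall>i. \<bar>i\<bar> \<le> int n \<longrightarrow> h i \<in> V) \<and>
      (\<forall>i j. \<bar>i\<bar> \<le> int n \<longrightarrow> \<bar>j\<bar> \<le> int n \<longrightarrow> vertex_dist E (h i) (h j) = nat \<bar>i - j\<bar>)"
  obtains v :: "int \<Rightarrow> 'a" where "\<And>i. v i \<in> V" "\<And>i j. vertex_dist E (v i) (v j) = nat \<bar>i - j\<bar>"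
proof -
  have "\<forall>n. \<exists>h :: int \<Rightarrow> 'a. h 0 = p \<and> (\<forall>i. \<bar>i\<bar> \<le> int n \<longrightarrow> h i \<in> V) \<and>
      (\<forall>i j. \<bar>i\<bar> \<le> int n \<longrightarrow> \<bar>j\<bar> \<le> int n \<longrightarrow> vertex_dist E (h i) (h j) = nat \<bar>i - j\<bar>)"
    using seg by (rule allI)
  then obtain H where H: "\<forall>n. H n 0 = p \<and> (\<forall>i. \<bar>i\<bar> \<le> int n \<longrightarrow> H n i \<in> V) \<and>
      (\<forall>i j. \<bar>i\<bar> \<le> int n \<longrightarrow> \<bar>j\<bar> \<le> int n \<longrightarrow> vertex_dist E (H n i) (H n j) = nat \<bar>i - j\<bar>)"
    by (rule choice[THEN exE])
  have H0: "H n 0 = p" and HV: "\<bar>i\<bar> \<le> int n \<Longrightarrow> H n i \<in> V"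
    and Hgeo: "\<bar>i\<bar> \<le> int n \<Longrightarrow> \<bar>j\<bar> \<le> int n \<Longrightarrow> vertex_dist E (H n i) (H n j) = nat \<bar>i - j\<bar>" for n i j
    using H by blast+
  define P where "P k N \<longleftrightarrow> infinite N \<and> (\<forall>a\<in>N. \<forall>b\<in>N. \<forall>i. \<bar>i\<bar> \<le> int k \<longrightarrow> H a i = H b i)" for k and N :: "nat set"
  have "\<exists>N. \<forall>k. P k (N k) \<and> N (Suc k) \<subseteq> N k"
  proof (rule dependent_nat_choice)
    show "\<exists>N. P 0 N" by (intro exI[of _ UNIV]) (auto simp: P_def H0)
  next
    fix N k assume PN: "P k N"
    \<comment> \<open>Only \<open>H n\<close> with \<open>n\<close> at least \<open>k + 1\<close> is
      controlled at the two new parameters.\<close>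
    define N' where "N' = N \<inter> {Suc k..}"
    have "N = N' \<union> (N \<inter> {..k})" by (auto simp: N'_def)
    then have infN': "infinite N'" using PN by (metis P_def finite_Int finite_UnI finite_atMost)
    define f where "f n = (H n (int (Suc k)), H n (- int (Suc k)))" for n
    define B where "B = {w. (p, w) \<in> E ^^ Suc k}"
    have "f n \<in> B \<times> B" if "n \<in> N'" for n
    proof -
      have n: "Suc k \<le> n" using that by (simp add: N'_def)
      have "H n i \<in> B" if "\<bar>i\<bar> = int (Suc k)" for i
      proof -
        have "vertex_dist E p (H n i) = Suc k"
          using Hgeo[of 0 n i] that n by (simp add: H0 nat_eq_iff)
        then show ?thesis
          using vertex_dist_relpow[OF p HV[of i n]] that n by (simp add: B_def del: relpow.simps)
      qed
      then show ?thesis by (simp add: f_def)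
    qed
    then have "f ` N' \<subseteq> B \<times> B" by blast
    moreover have "finite (B \<times> B)"
      unfolding B_def by (intro finite_cartesian_product finite_relpow_ball fin)
    ultimately have "finite (f ` N')" by (rule finite_subset)
    from pigeonhole_infinite[OF infN' this]
    obtain a where a: "a \<in> N'" "infinite {n \<in> N'. f n = f a}" by (rule bexE)
    define N'' where "N'' = {n \<in> N'. f n = f a}"
    have "H b i = H c i" if bc: "b \<in> N''" "c \<in> N''" and i: "\<bar>i\<bar> \<le> int (Suc k)" for b c i
    proof (cases "\<bar>i\<bar> \<le> int k")
      case True
      then show ?thesis using PN bc by (auto simp: P_def N''_def N'_def)
    next
      case False
      then have "i = int (Suc k) \<or> i = - int (Suc k)" using i by auto
      then show ?thesis using bc by (auto simp: N''_def f_def)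
    qed
    moreover have "infinite N''" using a(2) by (simp add: N''_def)
    ultimately have "P (Suc k) N''" unfolding P_def by blast
    moreover have "N'' \<subseteq> N" by (auto simp: N''_def N'_def)
    ultimately show "\<exists>N'. P (Suc k) N' \<and> N' \<subseteq> N" by blast
  qed
  then obtain N where "\<forall>k. P k (N k) \<and> N (Suc k) \<subseteq> N k" by (rule exE)
  then have N: "P k (N k)" "N (Suc k) \<subseteq> N k" for k by simp_all
  have anti: "N l \<subseteq> N k" if "k \<le> l" for k l
    using N(2) that by (rule lift_Suc_antimono_le)
  \<comment> \<open>Agreement in \<open>P\<close> makes the value independent of the index
    selected.\<close>
  define v where "v i = H (SOME a. a \<in> N (nat \<bar>i\<bar>)) i" for i
  have v: "v i = H a i" if "a \<in> N k" "\<bar>i\<bar> \<le> int k" for i a k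
  proof -
    have "nat \<bar>i\<bar> \<le> k" using that by simp
    then have a: "a \<in> N (nat \<bar>i\<bar>)" using anti that by blast
    then have "(SOME a. a \<in> N (nat \<bar>i\<bar>)) \<in> N (nat \<bar>i\<bar>)" by (rule someI)
    moreover have "\<bar>i\<bar> \<le> int (nat \<bar>i\<bar>)" by simp
    ultimately show ?thesis using a N(1)[of "nat \<bar>i\<bar>"] unfolding P_def v_def by blast
  qed
  have pick: "\<exists>a\<in>N k. k \<le> a" for k
    using N(1)[of k] by (auto simp: P_def infinite_nat_iff_unbounded_le)
  show thesis
  proof
    show "v i \<in> V" for i
      using pick[of "nat \<bar>i\<bar>"] v[of _ "nat \<bar>i\<bar>" i] HV[of i] by force
    show "vertex_dist E (v i) (v j) = nat \<bar>i - j\<bar>" for i j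
    proof -
      define k where "k = nat (max \<bar>i\<bar> \<bar>j\<bar>)"
      obtain a where a: "a \<in> N k" "k \<le> a" using pick by blast
      have "\<bar>i\<bar> \<le> int k" "\<bar>j\<bar> \<le> int k" by (auto simp: k_def)
      then show ?thesis using v[OF a(1)] Hgeo[of i a j] a(2) by simp
    qed
  qed
qed

text \<open>Balls are finite, so some vertex is farther than \<open>N\<close> from \<open>p\<close>.
  No part of a shortest walk to it can be shortened.\<close>

lemma geodesic_segments:
  assumes fin: "\<And>u. finite (E `` {u})" and V: "infinite V" and p: "p \<in> V"
  obtains f :: "nat \<Rightarrow> 'a" where "\<And>i. i \<le> N \<Longrightarrow> f i \<in> V"
    "\<And>i j. i \<le> j \<Longrightarrow> j \<le> N \<Longrightarrow> vertex_dist E (f i) (f j) = j - i"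
proof -
  have "finite (\<Union>k\<le>N. {w. (p, w) \<in> E ^^ k})" using finite_relpow_ball[OF fin] by blast
  then have "\<not> V \<subseteq> (\<Union>k\<le>N. {w. (p, w) \<in> E ^^ k})"
    using V finite_subset by metis
  then obtain w where w: "w \<in> V" "w \<notin> (\<Union>k\<le>N. {w. (p, w) \<in> E ^^ k})"
    by blast
  define L where "L = vertex_dist E p w"
  have path: "(p, w) \<in> E ^^ L" using vertex_dist_relpow[OF p w(1)] by (simp add: L_def)
  then have LN: "N < L" using w(2) by (meson UN_I atMost_iff mem_Collect_eq not_le)
  obtain f where f: "f 0 = p" "f L = w" "\<And>i. i < L \<Longrightarrow> (f i, f (Suc i)) \<in> E"
    using path unfolding relpow_fun_conv by blast
  have walk: "(f i, f (i + k)) \<in> E ^^ k" if "i + k \<le> L" for i k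
    using that
  proof (induction k)
    case (Suc k)
    then show ?case using f(3)[of "i + k"] by auto
  qed simp
  have fV: "f i \<in> V" if "i \<le> L" for i
  proof (cases "i = L")
    case False
    then show ?thesis using f(3)[of i] that edges by auto
  qed (use f(2) w(1) in simp)
  have "vertex_dist E (f i) (f j) = j - i" if ij: "i \<le> j" "j \<le> N" for i j
  proof -
    have V: "f 0 \<in> V" "f i \<in> V" "f j \<in> V" "f L \<in> V" using fV ij LN by auto
    have "vertex_dist E (f 0) (f i) \<le> i" "vertex_dist E (f j) (f L) \<le> L - j"
      "vertex_dist E (f i) (f j) \<le> j - i"
      using walk[of 0 i] walk[of j "L - j"] walk[of i "j - i"] ij LN by (auto intro!: vertex_dist_le)
    then show ?thesis
      using vertex_dist_triangle[OF V(1,2,4)] vertex_dist_triangle[OF V(2,3,4)] ij LN f(1,2)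
      by (simp add: L_def)
  qed
  then show thesis using that[of f] fV LN by simp
qed

end

section \<open>Cayley graphs of infinite groups\<close>

lemma asdim_eq_enatD:
  assumes "asdim m < \<infinity>"
  obtains k where "asdim m = enat k" "asdim_le m k"
proof -
  let ?A = "{enat n |n. asdim_le m n}"
  have "?A \<noteq> {}"
  proof
    assume "?A = {}"
    then show False using assms by (simp add: asdim_def Inf_enat_def)
  qed
  then obtain a where "a \<in> ?A" by blast
  \<comment> \<open>The extended naturals are well-ordered, so the infimum is a minimum.\<close>
  then have "(LEAST x. x \<in> ?A) \<in> ?A" by (rule LeastI)
  moreover have "asdim m = (LEAST x. x \<in> ?A)"
    using \<open>?A \<noteq> {}\<close> unfolding asdim_def Inf_enat_def by (rule if_not_P)
  ultimately have "asdim m \<in> ?A" by simp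
  then show thesis using that by blast
qed

lemma asdim_le_imp: "asdim_le m n \<Longrightarrow> asdim m \<le> enat n"
  unfolding asdim_def by (intro Inf_lower) blast

lemma asdim_le_0_if_bounded:
  assumes "\<And>x y. x \<in> mspace m \<Longrightarrow> y \<in> mspace m \<Longrightarrow> mdist m x y \<le> D"
  shows "asdim_le m 0"
  unfolding asdim_le_def
proof (intro allI impI exI[of _ "{mspace m}"] conjI ballI)
  fix R :: real and x assume "R > 0" "x \<in> mspace m"
  have "{U \<in> {mspace m}. U \<inter> mcball_of m x R \<noteq> {}} \<subseteq> {mspace m}" by blast
  then show "finite {U \<in> {mspace m}. U \<inter> mcball_of m x R \<noteq> {}}"
    "card {U \<in> {mspace m}. U \<inter> mcball_of m x R \<noteq> {}} \<le> 0 + 1"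
    using card_mono[of "{mspace m}"] by (fastforce intro: finite_subset)+
qed (use assms in \<open>auto simp: uniformly_bounded_cover_def\<close>)

lemma (in connected_graph) asdim_le_0_if_finite:
  assumes "finite V"
  shows "asdim_le (graph_metric V E) 0"
proof (rule asdim_le_0_if_bounded)
  fix \<phi> \<psi> assume "\<phi> \<in> mspace (graph_metric V E)" "\<psi> \<in> mspace (graph_metric V E)"
  then have R: "\<phi> \<in> realization V E" "\<psi> \<in> realization V E" by simp_all
  obtain u v where uv: "u \<in> supp \<phi>" "v \<in> supp \<psi>" using supp_facts(2) R by blast
  then have "u \<in> V" "v \<in> V" using supp_facts(3) R by blast+
  then have "vertex_dist E u v \<le> Max ((\<lambda>(u, v). vertex_dist E u v) ` (V \<times> V))"
    using assms by (intro Max_ge) auto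
  \<comment> \<open>The summand 2 allows for a distance of at most 1 from each point to a vertex of
    its support.\<close>
  then show "mdist (graph_metric V E) \<phi> \<psi> \<le> 2 + real (Max ((\<lambda>(u, v). vertex_dist E u v) ` (V \<times> V)))"
    using path_dist_le[OF R uv] supp_facts(5)[OF R(1), of u] supp_facts(5)[OF R(2), of v]
    by (simp add: mdist_graph_metric R)
qed

section \<open>Left translations of Cayley graphs\<close>

lemma (in group) cayley_edge_translate:
  assumes "S \<subseteq> carrier G" "g \<in> carrier G" "(u, v) \<in> cayley_edges G S"
  shows "(g \<otimes> u, g \<otimes> v) \<in> cayley_edges G S"
  using assms by (auto simp: cayley_edges_def m_assoc subset_iff)

text \<open>Edges come from right multiplication, so left translations map walks to walks;
  translating back by \<open>inv g\<close> gives the reverse inequality.\<close>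

lemma (in group) vertex_dist_translate:
  assumes S: "finite_generating_set G S" and c: "g \<in> carrier G" "u \<in> carrier G" "v \<in> carrier G"
  shows "vertex_dist (cayley_edges G S) (g \<otimes> u) (g \<otimes> v) = vertex_dist (cayley_edges G S) u v"
proof -
  interpret connected_graph "carrier G" "cayley_edges G S"
    using connected_graph_cayley[OF S] .
  have SG: "S \<subseteq> carrier G" using S by (simp add: finite_generating_set_def)
  have path: "(g \<otimes> u, g \<otimes> v) \<in> cayley_edges G S ^^ n"
    if "g \<in> carrier G" "(u, v) \<in> cayley_edges G S ^^ n" for g u v n
    using that(2)
  proof (induction n arbitrary: v)
    case (Suc n)
    then obtain w where "(u, w) \<in> cayley_edges G S ^^ n" "(w, v) \<in> cayley_edges G S" by auto
    then show ?case
      using Suc.IH cayley_edge_translate[OF SG that(1)] by auto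
  qed simp
  have le: "vertex_dist (cayley_edges G S) (g \<otimes> u) (g \<otimes> v) \<le> vertex_dist (cayley_edges G S) u v"
    if "g \<in> carrier G" "u \<in> carrier G" "v \<in> carrier G" for g u v
    using vertex_dist_le[OF path[OF that(1) vertex_dist_relpow[OF that(2,3)]]] .
  have "inv g \<otimes> (g \<otimes> u) = u" "inv g \<otimes> (g \<otimes> v) = v"
    using c by (simp_all add: m_assoc[symmetric])
  then show ?thesis
    using le[OF c] le[of "inv g" "g \<otimes> u" "g \<otimes> v"] c by simp
qed

lemma (in group) finite_cayley_neighbours:
  assumes "finite_generating_set G S"
  shows "finite (cayley_edges G S `` {u})"
proof (rule finite_subset)
  have S: "finite S" "S \<subseteq> carrier G" using assms by (auto simp: finite_generating_set_def)
  show "cayley_edges G S `` {u} \<subseteq> (\<lambda>s. u \<otimes> s) ` S \<union> (\<lambda>s. u \<otimes> inv s) ` S"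
    using S(2) by (force simp: cayley_edges_def m_assoc subset_iff image_iff)
  show "finite ((\<lambda>s. u \<otimes> s) ` S \<union> (\<lambda>s. u \<otimes> inv s) ` S)" using S(1) by simp
qed

text \<open>Long geodesic segments are translated so that their midpoints coincide.\<close>

lemma (in group) cayley_bi_infinite_geodesic:
  assumes S: "finite_generating_set G S" and inf: "infinite (carrier G)"
  obtains v :: "int \<Rightarrow> 'a" where "\<And>i. v i \<in> carrier G"
    "\<And>i j. vertex_dist (cayley_edges G S) (v i) (v j) = nat \<bar>i - j\<bar>"
proof -
  interpret connected_graph "carrier G" "cayley_edges G S"
    using connected_graph_cayley[OF S] .
  let ?vd = "vertex_dist (cayley_edges G S)"
  have "\<exists>h :: int \<Rightarrow> 'a. h 0 = \<one> \<and> (\<forall>i. \<bar>i\<bar> \<le> int n \<longrightarrow> h i \<in> carrier G) \<and>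
      (\<forall>i j. \<bar>i\<bar> \<le> int n \<longrightarrow> \<bar>j\<bar> \<le> int n \<longrightarrow> ?vd (h i) (h j) = nat \<bar>i - j\<bar>)" for n
  proof -
    obtain f where f: "\<And>i. i \<le> 2 * n \<Longrightarrow> f i \<in> carrier G"
      "\<And>i j. i \<le> j \<Longrightarrow> j \<le> 2 * n \<Longrightarrow> ?vd (f i) (f j) = j - i"
      by (rule geodesic_segments[OF finite_cayley_neighbours[OF S] inf one_closed, of "2 * n"]) (rule that)
    define h where "h i = inv (f n) \<otimes> f (nat (i + int n))" for i
    have fn: "f n \<in> carrier G" using f(1) by simp
    have fh: "f (nat (i + int n)) \<in> carrier G" if "\<bar>i\<bar> \<le> int n" for i using f(1) that by simp
    have le: "?vd (h i) (h j) = nat (j - i)" if "\<bar>i\<bar> \<le> int n" "\<bar>j\<bar> \<le> int n" "i \<le> j" for i j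
    proof -
      have "?vd (h i) (h j) = ?vd (f (nat (i + int n))) (f (nat (j + int n)))"
        unfolding h_def using fn fh that by (intro vertex_dist_translate[OF S]) auto
      also have "\<dots> = nat (j + int n) - nat (i + int n)"
        using that by (intro f(2)) auto
      finally show ?thesis using that by (simp add: nat_diff_distrib[symmetric])
    qed
    have "h 0 = \<one>" using fn by (simp add: h_def)
    moreover have hG: "h i \<in> carrier G" if "\<bar>i\<bar> \<le> int n" for i using fn fh[OF that] by (simp add: h_def)
    moreover have "?vd (h i) (h j) = nat \<bar>i - j\<bar>" if "\<bar>i\<bar> \<le> int n" "\<bar>j\<bar> \<le> int n" for i j
    proof (cases "i \<le> j")
      case True
      then show ?thesis using le[of i j] that by simp
    next
      case False
      then show ?thesis
        using le[of j i] that vertex_dist_sym[OF hG[OF that(1)] hG[OF that(2)]] by simp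
    qed
    ultimately show ?thesis by blast
  qed
  then show thesis
    by (rule bi_infinite_geodesic[OF finite_cayley_neighbours[OF S] one_closed]) (rule that)
qed

theorem theorem1p3:
  fixes G :: "('a, 'b) monoid_scheme"
  assumes "group G" and "finitely_generated G"
    and "0 < group_asdim G" and "group_asdim G < \<infinity>"
  shows "\<exists>S Y. group_coarsely_separated_by G S Y \<and>
           asdim (submetric (Cay G S) Y) < group_asdim G"
proof -
  interpret group G by fact
  \<comment> \<open>The same choice as in \<open>group_asdim\<close>, so
    \<open>group_asdim G\<close> is by definition the dimension of this Cayley graph.\<close>
  define S where "S = (SOME S. finite_generating_set G S)"
  have S: "finite_generating_set G S"
    using assms(2) unfolding S_def finitely_generated_def by (rule someI_ex)
  have asdim_G: "group_asdim G = asdim (Cay G S)"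
    by (simp add: group_asdim_def S_def)
  interpret cg: connected_graph "carrier G" "cayley_edges G S"
    using connected_graph_cayley[OF S] .
  obtain k where k: "asdim (Cay G S) = enat k" "asdim_le (Cay G S) k"
    using asdim_eq_enatD assms(4) asdim_G by metis
  then obtain n where n: "k = Suc n"
    using assms(3) asdim_G by (cases k) (auto simp: zero_enat_def)
  \<comment> \<open>A finite Cayley graph is bounded and would have dimension 0.\<close>
  have "infinite (carrier G)"
  proof
    assume "finite (carrier G)"
    then have "asdim (Cay G S) \<le> enat 0"
      unfolding Cay_def by (intro asdim_le_imp cg.asdim_le_0_if_finite)
    then show False using assms(3) asdim_G by (simp add: zero_enat_def)
  qed
  then obtain v :: "int \<Rightarrow> 'a" where v: "\<And>i. v i \<in> carrier G"
    "\<And>i j. vertex_dist (cayley_edges G S) (v i) (v j) = nat \<bar>i - j\<bar>"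
    by (rule cayley_bi_infinite_geodesic[OF S]) (rule that)
  obtain \<gamma> :: "real \<Rightarrow> 'a \<Rightarrow> real" where \<gamma>: "\<And>t. \<gamma> t \<in> realization (carrier G) (cayley_edges G S)"
    "\<And>s t. mdist (graph_metric (carrier G) (cayley_edges G S)) (\<gamma> s) (\<gamma> t) = \<bar>s - t\<bar>"
    by (rule cg.isometric_line_of_geodesic[OF v]) (rule that)
  then have \<gamma>': "\<And>t. \<gamma> t \<in> mspace (Cay G S)" "\<And>s t. mdist (Cay G S) (\<gamma> s) (\<gamma> t) = \<bar>s - t\<bar>"
    by (simp_all add: Cay_def)
  obtain Y where Y: "Y \<subseteq> mspace (Cay G S)" "coarsely_separates (Cay G S) Y"
    "asdim_le (submetric (Cay G S) Y) n"
    by (rule isometric_line_coarsely_separated[OF k(2)[unfolded n] \<gamma>']) (rule that)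
  have "asdim (submetric (Cay G S) Y) \<le> enat n"
    using Y(3) by (rule asdim_le_imp)
  also have "\<dots> < group_asdim G" by (simp add: asdim_G k(1) n)
  finally show ?thesis
    using S Y unfolding group_coarsely_separated_by_def by blast
qed

end
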